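(* Let $X$ be a strictly locally convex plane curve in $\mathbb{R}^2$ with unit normal $N$ pointing to the convex side. For a point $P$ on $X$ and sufficiently small $h>0$, let $l$ be the line through $P+hN(P)$ parallel to the tangent $t$ of $X$ at $P$, let $G$ be the center of gravity of the section of $X$ cut off by $l$, and let $d_P(h)$ be the distance from $G$ to $t$. Then $X$ is an open part of a parabola if and only if it satisfies the following condition: For each point $P$ on $X$ and every sufficiently small $h>0$, $$d_P(h)=\frac{3}{5}h.$$
   Context: All curves are of class $C^{3}$ and connected. A regular plane curve $X:I\to\mathbb{R}^2$ ($I$ an open interval) is convex if for every $s\in I$ the trace $X(I)$ lies entirely on one side of the tangent line at $s$ (in one of the closed half-planes it determines). It is locally convex if for each $s\in I$ there is an open subinterval $J\subset I$ containing $s$ such that $X|_J$ is convex. A locally convex curve $X$ is called strictly locally convex if it is of class $C^{3}$ and has positive curvature $\kappa$ with respect to the unit normal $N$ pointing to the convex side, i.e. $\kappa(s)=\langle X''(s),N(X(s))\rangle>0$ for an arc-length parametrization $X(s)$. For a point $P$ on $X$ and sufficiently small $h>0$ (how small may depend on $P$), the line $l$ through $P+hN(P)$ parallel to the tangent at $P$ meets $X$ near $P$ in two points $A,B$, one on each side of $P$ along the curve. The section of $X$ cut off by $l$ is the bounded planar region enclosed by the arc of $X$ from $A$ to $B$ through $P$ and the chord $AB$. Its center of gravity is its centroid (with uniform density). "An open part of a parabola" means a connected relatively open subset of a parabola. *)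

theory Defs
  imports "HOL-Analysis.Analysis"
begin

(* For k = 1 this is C1_differentiable_on; all derivatives are two-sided, so C_diff_on is
   meant for open sets. *)
primrec C_diff_on :: "nat \<Rightarrow> (real \<Rightarrow> 'a::real_normed_vector) \<Rightarrow> real set \<Rightarrow> bool" where
  "C_diff_on 0 f S \<longleftrightarrow> continuous_on S f"
| "C_diff_on (Suc k) f S \<longleftrightarrow>
     (\<forall>x\<in>S. f differentiable (at x)) \<and> C_diff_on k (\<lambda>x. vector_derivative f (at x)) S"

definition open_interval :: "real set \<Rightarrow> bool" where
  "open_interval I \<longleftrightarrow> open I \<and> is_interval I \<and> I \<noteq> {}"

definition regular_curve :: "(real \<Rightarrow> real^2) \<Rightarrow> real set \<Rightarrow> bool" where
  "regular_curve X I \<longleftrightarrow>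
     open_interval I \<and> C_diff_on 3 X I \<and> (\<forall>s\<in>I. vector_derivative X (at s) \<noteq> 0)"

definition tangent_line :: "(real \<Rightarrow> real^2) \<Rightarrow> real \<Rightarrow> (real^2) set" where
  "tangent_line X s = {X s + c *\<^sub>R vector_derivative X (at s) | c. True}"

definition convex_curve :: "(real \<Rightarrow> real^2) \<Rightarrow> real set \<Rightarrow> bool" where
  "convex_curve X J \<longleftrightarrow> regular_curve X J \<and>
     (\<forall>s\<in>J. \<exists>n. n \<noteq> 0 \<and> n \<bullet> vector_derivative X (at s) = 0 \<and>
        X ` J \<subseteq> {p. (p - X s) \<bullet> n \<ge> 0})"

definition locally_convex_curve :: "(real \<Rightarrow> real^2) \<Rightarrow> real set \<Rightarrow> bool" where
  "locally_convex_curve X I \<longleftrightarrow> regular_curve X I \<and>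
     (\<forall>s\<in>I. \<exists>J. s \<in> J \<and> J \<subseteq> I \<and> convex_curve X J)"

(* The normal is indexed by the parameter rather than by the point, because the curve may
   have self-intersections. *)
definition convex_side_unit_normal :: "(real \<Rightarrow> real^2) \<Rightarrow> real set \<Rightarrow> (real \<Rightarrow> real^2) \<Rightarrow> bool" where
  "convex_side_unit_normal X I N \<longleftrightarrow>
     (\<forall>s\<in>I. norm (N s) = 1 \<and> N s \<bullet> vector_derivative X (at s) = 0 \<and>
        (\<exists>J. s \<in> J \<and> J \<subseteq> I \<and> convex_curve X J \<and> X ` J \<subseteq> {p. (p - X s) \<bullet> N s \<ge> 0}))"

(* Changes of parameter may reverse the orientation; the inverse of \<phi> is automatically C^3,
   since the unit speed condition forces the derivative of \<phi> to be nonzero. *)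
definition arc_length_reparam :: "(real \<Rightarrow> real^2) \<Rightarrow> real set \<Rightarrow> (real \<Rightarrow> real) \<Rightarrow> real set \<Rightarrow> bool" where
  "arc_length_reparam X I \<phi> J \<longleftrightarrow>
     open_interval J \<and> bij_betw \<phi> J I \<and> C_diff_on 3 \<phi> J \<and>
     (\<forall>u\<in>J. norm (vector_derivative (X \<circ> \<phi>) (at u)) = 1)"

(* The curvature, with respect to the normal field N, of a curve Y parametrized by arc length. *)
definition curvature :: "(real \<Rightarrow> real^2) \<Rightarrow> (real \<Rightarrow> real^2) \<Rightarrow> real \<Rightarrow> real" where
  "curvature Y N u = vector_derivative (\<lambda>v. vector_derivative Y (at v)) (at u) \<bullet> N u"

definition strictly_locally_convex ::
  "(real \<Rightarrow> real^2) \<Rightarrow> real set \<Rightarrow> (real \<Rightarrow> real^2) \<Rightarrow> bool" where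
  "strictly_locally_convex X I N \<longleftrightarrow>
     locally_convex_curve X I \<and> convex_side_unit_normal X I N \<and>
     (\<exists>\<phi> J. arc_length_reparam X I \<phi> J \<and> (\<forall>u\<in>J. curvature (X \<circ> \<phi>) (N \<circ> \<phi>) u > 0))"

definition cutting_line ::
  "(real \<Rightarrow> real^2) \<Rightarrow> (real \<Rightarrow> real^2) \<Rightarrow> real \<Rightarrow> real \<Rightarrow> (real^2) set" where
  "cutting_line X N s h = {X s + h *\<^sub>R N s + c *\<^sub>R vector_derivative X (at s) | c. True}"

(* A = X a and B = X b are the two intersections near P = X s: the first points, going from P
   along the curve in either direction, that lie on the line. *)
definition chord_params ::
  "(real \<Rightarrow> real^2) \<Rightarrow> real set \<Rightarrow> (real \<Rightarrow> real^2) \<Rightarrow> real \<Rightarrow> real \<Rightarrow> real \<Rightarrow> real \<Rightarrow> bool" where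
  "chord_params X I N s h a b \<longleftrightarrow>
     a < s \<and> s < b \<and> {a..b} \<subseteq> I \<and>
     X a \<in> cutting_line X N s h \<and> X b \<in> cutting_line X N s h \<and>
     (\<forall>t\<in>{a<..<b}. X t \<notin> cutting_line X N s h)"

lemma chord_params_unique:
  assumes "chord_params X I N s h a b" and "chord_params X I N s h a' b'"
  shows "a = a'" and "b = b'"
proof -
  have *: "\<not> a < a'" "\<not> b' < b"
    if "chord_params X I N s h a b" "chord_params X I N s h a' b'" for a b a' b'
  proof -
    have "a' \<notin> {a<..<b}" "b' \<notin> {a<..<b}"
      using that unfolding chord_params_def by blast+
    moreover have "a' < s" "s < b" "a < s" "s < b'"
      using that unfolding chord_params_def by blast+
    ultimately show "\<not> a < a'" "\<not> b' < b"
      by simp_all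
  qed
  show "a = a'" "b = b'"
    using *[OF assms] *[OF assms(2) assms(1)] by linarith+
qed

definition curve_section ::
  "(real \<Rightarrow> real^2) \<Rightarrow> real set \<Rightarrow> (real \<Rightarrow> real^2) \<Rightarrow> real \<Rightarrow> real \<Rightarrow> (real^2) set" where
  "curve_section X I N s h =
     (let (a, b) = (THE (a, b). chord_params X I N s h a b)
      in inside (X ` {a..b} \<union> closed_segment (X a) (X b)))"

lemma curve_section_eq:
  assumes "chord_params X I N s h a b"
  shows "curve_section X I N s h = inside (X ` {a..b} \<union> closed_segment (X a) (X b))"
proof -
  have "(THE (a, b). chord_params X I N s h a b) = (a, b)"
  proof (rule the_equality)
    show "case (a, b) of (a, b) \<Rightarrow> chord_params X I N s h a b"
      using assms by simp
    show "p = (a, b)" if "case p of (a, b) \<Rightarrow> chord_params X I N s h a b" for p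
      using that chord_params_unique[OF _ assms, of "fst p" "snd p"]
      by (simp add: case_prod_unfold prod_eq_iff)
  qed
  then show ?thesis
    by (simp add: curve_section_def)
qed

definition centroid :: "(real^2) set \<Rightarrow> real^2" where
  "centroid S = (1 / measure lebesgue S) *\<^sub>R (LINT x:S|lebesgue. x)"

(* d_P(h) for the point P = X s. *)
definition centroid_dist ::
  "(real \<Rightarrow> real^2) \<Rightarrow> real set \<Rightarrow> (real \<Rightarrow> real^2) \<Rightarrow> real \<Rightarrow> real \<Rightarrow> real" where
  "centroid_dist X I N s h = infdist (centroid (curve_section X I N s h)) (tangent_line X s)"

(* F is the focus and L the directrix. *)
definition parabola :: "(real^2) set \<Rightarrow> bool" where
  "parabola Q \<longleftrightarrow>
     (\<exists>F L. affine L \<and> aff_dim L = 1 \<and> F \<notin> L \<and> Q = {p. dist p F = infdist p L})"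

definition open_part_of_parabola :: "(real^2) set \<Rightarrow> bool" where
  "open_part_of_parabola S \<longleftrightarrow>
     (\<exists>Q. parabola Q \<and> openin (top_of_set Q) S \<and> connected S)"

end

theory Submission
  imports Defs
begin

text \<open>For a point \<open>P\<close> let \<open>W(y)\<close> be the length of the chord at height \<open>y\<close> above the tangent. The
  section has area \<open>\<integral>\<^sub>0\<^sup>h W\<close> and first moment \<open>\<integral>\<^sub>0\<^sup>h y W\<close>, so \<open>d\<^sub>P(h) = 3h/5\<close> for all small \<open>h\<close> amounts,
  after differentiation, to \<open>W(h) = c\<^sub>P \<surd>h\<close>. This holds for parabolas.

  Conversely, how small \<open>h\<close> must be depends on \<open>P\<close>, but Baire's theorem provides an open arc on which
  the square root law holds uniformly. There one may differentiate the chord with respect to its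
  height and its base point; comparing the two derivatives shows that the midpoints of the parallel
  chords lie on a line, so the arc is part of a parabola. Finally, if the curve follows a parabola
  up to a point \<open>P\<close>, then the known ends of the short chords at \<open>P\<close>, together with their lengths, put
  their other ends on the same parabola, which therefore contains the whole curve.\<close>

section \<open>Strictly convex graphs and their chords\<close>

text \<open>All chords of a short arc are studied in one chart, as a graph over the tangent at a
  single point, instead of each over its own tangent. With q = sqrt (1 + f'(s)^2), the normal
  distance from the tangent at s is the vertical gap divided by q, and a chord parallel to that
  tangent has length q times its width in the abscissa. Since q depends on s alone, the square root
  law passes between the two pictures with a changed constant, and moving the base point becomes
  calculus for one function of two variables.

  The number 3/5 is (2/5) / (2/3), from the integrals of y sqrt y and of sqrt y over [0, h].

  The obstacle is that the law controls only the sum of the two half chords, not how the base point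
  divides it. On an arc with uniform control the division is recovered by varying the base point. At
  the border of an arc already known, it is recovered from the fact that both half chords are sqrt
  (2 h / f''(s)) to leading order: this fixes the coefficient of the parabola and selects the
  correct square root.\<close>

locale convex_graph =
  fixes f f' f'' :: "real \<Rightarrow> real" and l r :: real
  assumes deriv1: "t \<in> {l..r} \<Longrightarrow> (f has_real_derivative f' t) (at t)"
    and deriv2: "t \<in> {l..r} \<Longrightarrow> (f' has_real_derivative f'' t) (at t)"
    and pos: "t \<in> {l..r} \<Longrightarrow> f'' t > 0"
begin

text \<open>The vertical height of the graph at \<open>t\<close> over the tangent at
  \<open>s\<close>, that is, the first-order Taylor remainder. Unlike the normal distance it is
  differentiated easily in both variables.\<close>

definition gap :: "real \<Rightarrow> real \<Rightarrow> real" where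
  "gap t s = f t - f s - f' s * (t - s)"

lemma gap_self [simp]: "gap s s = 0"
  by (simp add: gap_def)

lemma deriv_less: "\<lbrakk>a \<in> {l..r}; b \<in> {l..r}; a < b\<rbrakk> \<Longrightarrow> f' a < f' b"
  by (rule DERIV_pos_imp_increasing[of a b f'])
     (auto intro!: exI deriv2 pos)

lemma gap_deriv: "t \<in> {l..r} \<Longrightarrow> ((\<lambda>t. gap t s) has_real_derivative f' t - f' s) (at t)"
  unfolding gap_def by (auto intro!: derivative_eq_intros deriv1)

lemma gap_continuous: "A \<subseteq> {l..r} \<Longrightarrow> continuous_on A (\<lambda>t. gap t s)"
  by (rule DERIV_continuous_on[OF has_field_derivative_at_within[OF gap_deriv]]) auto

lemma gap_less_right:
  assumes "l \<le> s" "s \<le> a" "a < b" "b \<le> r" shows "gap a s < gap b s"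
proof (rule DERIV_pos_imp_increasing_open[of a b "\<lambda>t. gap t s"])
  show "\<exists>y. DERIV (\<lambda>t. gap t s) t :> y \<and> 0 < y" if "a < t" "t < b" for t
    using gap_deriv[of t s] deriv_less[of s t] assms that by (intro exI[of _ "f' t - f' s"]) auto
qed (use assms in \<open>auto intro: gap_continuous\<close>)

lemma gap_less_left:
  assumes "l \<le> a" "a < b" "b \<le> s" "s \<le> r" shows "gap b s < gap a s"
proof (rule DERIV_neg_imp_decreasing_open[of a b "\<lambda>t. gap t s"])
  show "\<exists>y. DERIV (\<lambda>t. gap t s) t :> y \<and> y < 0" if "a < t" "t < b" for t
    using gap_deriv[of t s] deriv_less[of t s] assms that by (intro exI[of _ "f' t - f' s"]) auto
qed (use assms in \<open>auto intro: gap_continuous\<close>)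

lemma gap_pos: "\<lbrakk>t \<in> {l..r}; s \<in> {l..r}; t \<noteq> s\<rbrakk> \<Longrightarrow> gap t s > 0"
  using gap_less_right[of s s t] gap_less_left[of t s s] by (cases "t < s") auto

lemma gap_nonneg: "\<lbrakk>t \<in> {l..r}; s \<in> {l..r}\<rbrakk> \<Longrightarrow> gap t s \<ge> 0"
  using gap_pos[of t s] by (cases "t = s") auto

text \<open>The reflection t -> -t exchanges the two sides of the base point, so that several
  statements about left ends need not be proved again: they are the statements about right ends of
  the reflected graph.\<close>

lemma mirror: "convex_graph (\<lambda>t. f (- t)) (\<lambda>t. - f' (- t)) (\<lambda>t. f'' (- t)) (- r) (- l)"
proof
  fix t assume t: "t \<in> {- r..- l}"
  then have t': "- t \<in> {l..r}" by auto
  have u: "(uminus has_real_derivative - 1) (at t)" by (auto intro!: derivative_eq_intros)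
  show "((\<lambda>t. f (- t)) has_real_derivative - f' (- t)) (at t)"
    using DERIV_chain2[where g = uminus and x = t, OF deriv1[OF t'] u] by simp
  show "((\<lambda>t. - f' (- t)) has_real_derivative f'' (- t)) (at t)"
    using DERIV_minus[OF DERIV_chain2[where g = uminus and x = t, OF deriv2[OF t'] u]] by simp
  show "0 < f'' (- t)" using pos[OF t'] .
qed

lemma mirror_gap:
  "convex_graph.gap (\<lambda>t. f (- t)) (\<lambda>t. - f' (- t)) t s = gap (- t) (- s)"
  using convex_graph.gap_def[OF mirror] by (simp add: gap_def algebra_simps)

text \<open>Together with \<open>lt\<close>, the abscissas of the two ends of the chord parallel to
  the tangent at \<open>s\<close> and at vertical height \<open>h\<close> above it. They are
  meaningful for heights between 0 and the gap at \<open>r\<close>, respectively at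
  \<open>l\<close>, where strict monotonicity of the gap on each side makes the description
  unique.\<close>

definition rt :: "real \<Rightarrow> real \<Rightarrow> real" where
  "rt s h = (THE t. t \<in> {s..r} \<and> gap t s = h)"

definition lt :: "real \<Rightarrow> real \<Rightarrow> real" where
  "lt s h = (THE t. t \<in> {l..s} \<and> gap t s = h)"

lemma rt_eqI: "\<lbrakk>l \<le> s; s \<le> t; t \<le> r; gap t s = h\<rbrakk> \<Longrightarrow> rt s h = t"
  unfolding rt_def
  by (rule the_equality) (auto dest: gap_less_right[of s] simp: antisym_conv3 neq_iff, metis gap_less_right linorder_neqE_linordered_idom less_irrefl)

lemma lt_eqI: "\<lbrakk>s \<le> r; t \<le> s; l \<le> t; gap t s = h\<rbrakk> \<Longrightarrow> lt s h = t"
  unfolding lt_def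
  by (rule the_equality) (auto, metis gap_less_left linorder_neqE_linordered_idom less_irrefl)

lemma rt:
  assumes "l \<le> s" "s \<le> r" "0 \<le> h" "h \<le> gap r s"
  shows "s \<le> rt s h" "rt s h \<le> r" "gap (rt s h) s = h"
proof -
  obtain t where "s \<le> t" "t \<le> r" "gap t s = h"
    using IVT'[of "\<lambda>t. gap t s" s h r] assms gap_continuous[of "{s..r}" s] by auto
  with rt_eqI[of s t h] assms show "s \<le> rt s h" "rt s h \<le> r" "gap (rt s h) s = h" by auto
qed

lemma lt:
  assumes "l \<le> s" "s \<le> r" "0 \<le> h" "h \<le> gap l s"
  shows "lt s h \<le> s" "l \<le> lt s h" "gap (lt s h) s = h"
proof -
  obtain t where "l \<le> t" "t \<le> s" "gap t s = h"
    using IVT2'[of "\<lambda>t. gap t s" s h l] assms gap_continuous[of "{l..s}" s] by auto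
  with lt_eqI[of s t h] assms show "lt s h \<le> s" "l \<le> lt s h" "gap (lt s h) s = h" by auto
qed

lemma mirror_rt:
  assumes "l \<le> s" "s \<le> r" "0 \<le> h" "h \<le> gap l s"
  shows "convex_graph.rt (\<lambda>t. f (- t)) (\<lambda>t. - f' (- t)) (- l) (- s) h = - lt s h"
  by (rule convex_graph.rt_eqI[OF mirror]) (use assms lt[OF assms] in \<open>auto simp: mirror_gap\<close>)

lemma rt_strict:
  assumes "l \<le> s" "s \<le> r" "0 < h" "h < gap r s" shows "s < rt s h" "rt s h < r"
  using rt[of s h] assms by (auto simp: less_le)

lemma lt_strict:
  assumes "l \<le> s" "s \<le> r" "0 < h" "h < gap l s" shows "lt s h < s" "l < lt s h"
  using lt[of s h] assms by (auto simp: less_le)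

lemma rt_continuous_on:
  assumes "l \<le> s" "s \<le> r"
  shows "continuous_on {0..gap r s} (rt s)"
proof -
  have "continuous_on ((\<lambda>t. gap t s) ` {s..r}) (rt s)"
    by (rule continuous_on_inv) (use assms in \<open>auto intro!: gap_continuous rt_eqI\<close>)
  moreover have "{0..gap r s} \<subseteq> (\<lambda>t. gap t s) ` {s..r}"
  proof
    fix h assume "h \<in> {0..gap r s}"
    then show "h \<in> (\<lambda>t. gap t s) ` {s..r}"
      using rt[of s h] assms by (intro image_eqI[of _ _ "rt s h"]) auto
  qed
  ultimately show ?thesis using continuous_on_subset by blast
qed

lemma lt_continuous_on:
  assumes "l \<le> s" "s \<le> r"
  shows "continuous_on {0..gap l s} (lt s)"
proof -
  interpret m: convex_graph "\<lambda>t. f (- t)" "\<lambda>t. - f' (- t)" "\<lambda>t. f'' (- t)" "- r" "- l" by (rule mirror)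
  have "continuous_on {0..gap l s} (m.rt (- s))"
    using m.rt_continuous_on[of "- s"] assms by (simp add: mirror_gap)
  then have "continuous_on {0..gap l s} (\<lambda>h. - m.rt (- s) h)" by (intro continuous_intros)
  then show ?thesis
    by (rule continuous_on_eq) (use mirror_rt assms in auto)
qed

text \<open>At a point to the right, the tangent at the later base point runs higher, because the
  slope has increased. The monotonicity yields one height below which chords exist for a whole
  interval of base points.\<close>

lemma gap_anti_base:
  assumes "l \<le> s" "s \<le> q" "q \<le> t" "t \<le> r" shows "gap t q \<le> gap t s"
proof -
  have "gap t s - gap t q = gap q s + (f' q - f' s) * (t - q)" by (simp add: gap_def algebra_simps)
  moreover have "f' s \<le> f' q" using deriv_less[of s q] assms by (cases "s = q") auto
  ultimately show ?thesis using gap_nonneg[of q s] assms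
    by (smt (verit) atLeastAtMost_iff mult_nonneg_nonneg)
qed

lemma gap_mono_base:
  assumes "l \<le> t" "t \<le> p" "p \<le> s" "s \<le> r" shows "gap t p \<le> gap t s"
  using convex_graph.gap_anti_base[OF mirror, of "- s" "- p" "- t"] assms by (simp add: mirror_gap)

lemma gap_isCont_base: "s \<in> {l..r} \<Longrightarrow> isCont (\<lambda>s. gap t s) s"
  unfolding gap_def using DERIV_isCont[OF deriv1[of s]] DERIV_isCont[OF deriv2[of s]]
  by (intro continuous_intros) auto

lemma rt_isCont_base:
  assumes s: "l < s" "s < r" and h: "0 < h" "h < gap r s"
  shows "isCont (\<lambda>s. rt s h) s"
  unfolding isCont_def tendsto_iff
proof safe
  fix e :: real assume "e > 0"
  define z where "z = rt s h"
  have z: "s < z" "z < r" "gap z s = h" using rt_strict[of s h] rt[of s h] s h by (auto simp: z_def)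
  \<comment> \<open>\<open>z1\<close> is kept to the right of \<open>s\<close> however large
    \<open>e\<close> is, and \<open>z2\<close> is cut off at \<open>r\<close>. The strict
    inequalities between the gaps at \<open>z1\<close>, \<open>z2\<close> and \<open>h\<close>
    survive a small move of the base point, and the intermediate value theorem then traps the moved
    end between \<open>z1\<close> and \<open>z2\<close>.\<close>
  define z1 where "z1 = max (z - e/2) ((s + z)/2)"
  define z2 where "z2 = min (z + e/2) r"
  have "s < z1" using z by (simp add: z1_def less_max_iff_disj)
  then have z12: "s < z1" "z1 < z" "z < z2" "z2 \<le> r" "z - e < z1" "z2 < z + e"
    using z \<open>e > 0\<close> by (auto simp: z1_def z2_def)
  have "gap z1 s < h" "h < gap z2 s" using gap_less_right[of s z1 z] gap_less_right[of s z z2] z z12 s by auto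
  then have "\<forall>\<^sub>F s' in at s. gap z1 s' < h" "\<forall>\<^sub>F s' in at s. h < gap z2 s'"
    using order_tendstoD[OF isContD[OF gap_isCont_base[of s z1]], of h]
      order_tendstoD[OF isContD[OF gap_isCont_base[of s z2]], of h] s by auto
  moreover have "\<forall>\<^sub>F s' in at s. s' \<in> {l<..<z1}"
    by (rule eventually_at_in_open'[of "{l<..<z1}"]) (use s z12 in auto)
  ultimately show "\<forall>\<^sub>F s' in at s. dist (rt s' h) (rt s h) < e"
  proof eventually_elim
    case (elim s')
    have "\<exists>t\<ge>z1. t \<le> z2 \<and> gap t s' = h"
      using elim s z z12 by (intro IVT') (auto intro!: gap_continuous)
    then obtain t where t: "z1 \<le> t" "t \<le> z2" "gap t s' = h" by auto
    have "rt s' h = t" using t elim z12 by (intro rt_eqI) auto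
    then show ?case using t z12 by (auto simp: dist_real_def z_def)
  qed
qed

text \<open>Implicit differentiation of \<open>gap (z s) s = h\<close>: the partial derivatives of
  the gap are f'(z) - f'(s) in the first variable and -f''(s) (z - s) in the second. Since
  \<open>z\<close> is only known to be continuous, difference quotients are used, with the
  Caratheodory slope of \<open>f\<close> at \<open>z s\<close>.\<close>

lemma branch_deriv_base:
  assumes s: "s \<in> {l..r}" and z: "isCont z s" "z s \<in> {l..r}" "z s \<noteq> s"
    and gap: "\<forall>\<^sub>F s' in nhds s. gap (z s') s' = h"
  shows "(z has_real_derivative f'' s * (z s - s) / (f' (z s) - f' s)) (at s)"
proof -
  obtain q where q: "\<And>y. f y - f (z s) = q y * (y - z s)" "isCont q (z s)" "q (z s) = f' (z s)"
    using deriv1[OF z(2)] unfolding CARAT_DERIV by auto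
  \<comment> \<open>\<open>g s'\<close> is the height, at the fixed abscissa \<open>z s\<close>, of
    the tangent at \<open>s'\<close>. Subtracting the gap equations at \<open>s'\<close> and at
    \<open>s\<close> expresses the increment of \<open>z\<close> through the increment of
    \<open>g\<close>.\<close>
  define g where "g s' = f s' + f' s' * (z s - s')" for s'
  have g: "(g has_real_derivative f'' s * (z s - s)) (at s)"
    unfolding g_def by (auto intro!: derivative_eq_intros deriv1 deriv2 s)
  have lim1: "((\<lambda>s'. (g s' - g s) / (s' - s)) \<longlongrightarrow> f'' s * (z s - s)) (at s)"
    using g by (simp add: has_field_derivative_iff)
  have "isCont (\<lambda>s'. q (z s')) s" using isCont_o2[OF z(1) q(2)] .
  then have lim2: "((\<lambda>s'. q (z s') - f' s') \<longlongrightarrow> q (z s) - f' s) (at s)"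
    using DERIV_isCont[OF deriv2[OF s]] by (intro tendsto_diff) (auto simp: isCont_def)
  have ne: "f' (z s) - f' s \<noteq> 0"
    using deriv_less[of s "z s"] deriv_less[of "z s" s] s z by (cases "s < z s") auto
  have ev: "\<forall>\<^sub>F s' in at s. gap (z s') s' = h"
    using gap by (simp add: eventually_nhds eventually_at_filter) (metis)
  have gs: "gap (z s) s = h" using gap eventually_nhds_x_imp_x by blast
  have "\<forall>\<^sub>F s' in at s. q (z s') - f' s' \<noteq> 0"
    using tendsto_imp_eventually_ne[OF lim2, of 0] ne q by auto
  moreover have "\<forall>\<^sub>F s' in at s. s' \<noteq> s" by (rule eventually_neq_at_within)
  ultimately have "\<forall>\<^sub>F s' in at s. (g s' - g s) / (s' - s) / (q (z s') - f' s') = (z s' - z s) / (s' - s)"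
    using ev
  proof eventually_elim
    case (elim s')
    have "(q (z s') - f' s') * (z s' - z s) = g s' - g s"
      using q(1)[of "z s'"] gs elim unfolding g_def gap_def by (simp add: algebra_simps)
    then have "(g s' - g s) / (q (z s') - f' s') = z s' - z s"
      using elim by (metis eq_iff_diff_eq_0 nonzero_mult_div_cancel_left)
    then show ?case by (simp add: divide_divide_eq_left' flip: divide_divide_eq_left)
  qed
  then have "((\<lambda>s'. (z s' - z s) / (s' - s)) \<longlongrightarrow> f'' s * (z s - s) / (q (z s) - f' s)) (at s)"
    using tendsto_divide[OF lim1 lim2] ne q(3) by (simp add: tendsto_cong)
  then show ?thesis using q(3) by (simp add: has_field_derivative_iff)
qed

lemma rt_deriv_base:
  assumes s: "l < s" "s < r" and h: "0 < h" "h < gap r s"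
  shows "((\<lambda>s. rt s h) has_real_derivative f'' s * (rt s h - s) / (f' (rt s h) - f' s)) (at s)"
proof (rule branch_deriv_base)
  have "\<forall>\<^sub>F s' in nhds s. s' \<in> {l<..<r}"
    by (rule eventually_nhds_in_open) (use s in auto)
  moreover have "\<forall>\<^sub>F s' in nhds s. h < gap r s'"
    using order_tendstoD[OF gap_isCont_base[of s r, unfolded continuous_at], of h] s h
    by (auto simp: eventually_at_filter eventually_nhds; metis)
  ultimately show "\<forall>\<^sub>F s' in nhds s. gap (rt s' h) s' = h"
    by eventually_elim (use h rt in auto)
qed (use assms rt_isCont_base rt_strict[of s h] in auto)

lemma lt_deriv_base:
  assumes s: "l < s" "s < r" and h: "0 < h" "h < gap l s"
  shows "((\<lambda>s. lt s h) has_real_derivative f'' s * (lt s h - s) / (f' (lt s h) - f' s)) (at s)"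
proof -
  interpret m: convex_graph "\<lambda>t. f (- t)" "\<lambda>t. - f' (- t)" "\<lambda>t. f'' (- t)" "- r" "- l" by (rule mirror)
  have ev: "\<forall>\<^sub>F s' in nhds s. h < gap l s' \<and> s' \<in> {l<..<r}"
    using order_tendstoD[OF gap_isCont_base[of s l, unfolded continuous_at], of h] s h
      eventually_nhds_in_open[of "{l<..<r}" s]
    by (auto simp: eventually_at_filter eventually_conj_iff elim: eventually_mono)
  have u: "(uminus has_real_derivative - 1) (at s)" by (auto intro!: derivative_eq_intros)
  have "f'' s * (- lt s h + s) / (- f' (lt s h) + f' s) = f'' s * (lt s h - s) / (f' (lt s h) - f' s)"
    using minus_divide_divide[of "f'' s * (lt s h - s)" "f' (lt s h) - f' s"] by (simp add: algebra_simps)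
  then have "((\<lambda>s. - m.rt (- s) h) has_real_derivative f'' s * (lt s h - s) / (f' (lt s h) - f' s)) (at s)"
    using DERIV_minus[OF DERIV_chain2[where g = uminus and x = s and f = "\<lambda>s. m.rt s h", OF m.rt_deriv_base[of "- s" h] u]] assms
    by (simp add: mirror_gap mirror_rt)
  moreover have "\<forall>\<^sub>F s' in nhds s. - m.rt (- s') h = lt s' h"
    using ev by eventually_elim (use h mirror_rt in auto)
  ultimately show ?thesis by (subst (asm) DERIV_cong_ev[OF refl _ refl])
qed

lemma rt_deriv_height:
  assumes s: "l < s" "s < r" and h: "0 < h" "h < gap r s"
  shows "(rt s has_real_derivative inverse (f' (rt s h) - f' s)) (at h)"
proof (rule DERIV_inverse_function[of "\<lambda>t. gap t s" _ _ _ 0 "gap r s"])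
  note z = rt_strict[of s h]
  show "((\<lambda>t. gap t s) has_real_derivative f' (rt s h) - f' s) (at (rt s h))"
    using z assms by (intro gap_deriv) auto
  show "f' (rt s h) - f' s \<noteq> 0" using deriv_less[of s "rt s h"] z assms by auto
  have "continuous_on {0<..<gap r s} (rt s)"
    using rt_continuous_on[of s] s by (auto intro: continuous_on_subset)
  then show "isCont (rt s) h" using h by (simp add: continuous_on_eq_continuous_at)
qed (use assms rt in auto)

lemma lt_deriv_height:
  assumes s: "l < s" "s < r" and h: "0 < h" "h < gap l s"
  shows "(lt s has_real_derivative inverse (f' (lt s h) - f' s)) (at h)"
proof (rule DERIV_inverse_function[of "\<lambda>t. gap t s" _ _ _ 0 "gap l s"])
  note z = lt_strict[of s h]
  show "((\<lambda>t. gap t s) has_real_derivative f' (lt s h) - f' s) (at (lt s h))"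
    using z assms by (intro gap_deriv) auto
  show "f' (lt s h) - f' s \<noteq> 0" using deriv_less[of "lt s h" s] z assms by auto
  have "continuous_on {0<..<gap l s} (lt s)"
    using lt_continuous_on[of s] s by (auto intro: continuous_on_subset)
  then show "isCont (lt s) h" using h by (simp add: continuous_on_eq_continuous_at)
qed (use assms lt in auto)

end

section \<open>The square root law for chord widths\<close>

context convex_graph begin

text \<open>Quantifying over pairs of ends at equal height, instead of using \<open>rt\<close> and
  \<open>lt\<close>, restricts the law to heights at which the chord exists inside the chart, and
  makes it visibly invariant under reflection.\<close>

definition sqrt_width :: "real \<Rightarrow> real \<Rightarrow> real \<Rightarrow> bool" where
  "sqrt_width s c H \<longleftrightarrow>
     (\<forall>a b. l \<le> a \<and> a < s \<and> s < b \<and> b \<le> r \<and> gap a s = gap b s \<and> gap b s < H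
        \<longrightarrow> b - a = c * sqrt (gap b s))"

lemma sqrt_widthD:
  assumes "sqrt_width s c H" "l < s" "s < r" "0 < h" "h < H" "h < gap l s" "h < gap r s"
  shows "rt s h - lt s h = c * sqrt h"
  using assms rt[of s h] lt[of s h] rt_strict[of s h] lt_strict[of s h]
  unfolding sqrt_width_def by auto

lemma mirror_sqrt_width:
  "sqrt_width s c H \<Longrightarrow>
   convex_graph.sqrt_width (\<lambda>t. f (- t)) (\<lambda>t. - f' (- t)) (- r) (- l) (- s) c H"
  unfolding convex_graph.sqrt_width_def[OF mirror] mirror_gap
proof (intro allI impI)
  fix a b
  assume w: "sqrt_width s c H" and *: "- r \<le> a \<and> a < - s \<and> - s < b \<and> b \<le> - l \<and>
    gap (- a) (- (- s)) = gap (- b) (- (- s)) \<and> gap (- b) (- (- s)) < H"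
  show "b - a = c * sqrt (gap (- b) (- (- s)))"
    using w[unfolded sqrt_width_def, rule_format, of "- b" "- a"] * by auto
qed

text \<open>One application of L'Hopital's rule leaves half the difference quotient of
  \<open>f'\<close> at \<open>s\<close>, whose limit is known because \<open>f'' s\<close> is its
  derivative there.\<close>

lemma gap_quadratic:
  assumes "l < s" "s < r"
  shows "((\<lambda>t. gap t s / (t - s)\<^sup>2) \<longlongrightarrow> f'' s / 2) (at s)"
proof (rule lhopital[where f' = "\<lambda>t. f' t - f' s" and g' = "\<lambda>t. 2 * (t - s)"])
  have "s \<in> {l..r}" using assms by auto
  show "((\<lambda>t. gap t s) \<longlongrightarrow> 0) (at s)"
    using DERIV_isCont[OF gap_deriv[OF \<open>s \<in> {l..r}\<close>, of s]] by (simp add: isCont_def)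
  show "((\<lambda>t. (t - s)\<^sup>2) \<longlongrightarrow> 0) (at s)"
    by (auto intro!: tendsto_eq_intros)
  have ne: "\<forall>\<^sub>F t in at s. t \<noteq> s" by (rule eventually_neq_at_within)
  show "\<forall>\<^sub>F t in at s. (t - s)\<^sup>2 \<noteq> 0" "\<forall>\<^sub>F t in at s. 2 * (t - s) \<noteq> 0"
    using ne by (auto elim: eventually_mono)
  have "\<forall>\<^sub>F t in at s. t \<in> {l<..<r}"
    by (rule eventually_at_in_open') (use assms in auto)
  then show "\<forall>\<^sub>F t in at s. ((\<lambda>t. gap t s) has_real_derivative f' t - f' s) (at t)"
    by eventually_elim (auto intro: gap_deriv)
  show "\<forall>\<^sub>F t in at s. ((\<lambda>t. (t - s)\<^sup>2) has_real_derivative 2 * (t - s)) (at t)"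
    by (auto intro!: always_eventually derivative_eq_intros)
  have "((\<lambda>t. (f' t - f' s) / (t - s)) \<longlongrightarrow> f'' s) (at s)"
    using deriv2[OF \<open>s \<in> {l..r}\<close>] by (simp add: has_field_derivative_iff)
  then have "((\<lambda>t. (f' t - f' s) / (t - s) / 2) \<longlongrightarrow> f'' s / 2) (at s)"
    by (intro tendsto_intros) auto
  then show "((\<lambda>t. (f' t - f' s) / (2 * (t - s))) \<longlongrightarrow> f'' s / 2) (at s)"
    by (subst mult.commute) (simp only: divide_divide_eq_left)
qed

text \<open>Inserting t = \<open>rt s h\<close> into the quadratic asymptotics of the gap gives h ~
  f''(s)/2 (t - s)^2; the limit is the root of the inverse.\<close>

lemma rt_asymptotic:
  assumes s: "l < s" "s < r"
  shows "((\<lambda>h. (rt s h - s) / sqrt h) \<longlongrightarrow> sqrt (2 / f'' s)) (at_right 0)"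
proof -
  have g: "gap r s > 0" using gap_pos[of r s] s by auto
  have small: "\<forall>\<^sub>F h in at_right 0. h \<in> {0<..<gap r s}"
    using g by (auto simp: eventually_at_right_field)
  have "((rt s) \<longlongrightarrow> rt s 0) (at 0 within {0..gap r s})"
    using rt_continuous_on[of s] g s by (auto simp: continuous_on)
  moreover have "rt s 0 = s" using s by (intro rt_eqI) auto
  moreover have "at 0 within {0..gap r s} = at_right 0" using g by (rule at_within_Icc_at_right)
  ultimately have lim: "((rt s) \<longlongrightarrow> s) (at_right 0)" by simp
  have "filterlim (rt s) (at s) (at_right 0)"
    unfolding filterlim_at using lim small
    by (auto elim!: eventually_mono dest: rt_strict(1)[of s, rotated 2] simp: s less_imp_le)
  from filterlim_compose[OF gap_quadratic[OF s] this]
  have "((\<lambda>h. gap (rt s h) s / (rt s h - s)\<^sup>2) \<longlongrightarrow> f'' s / 2) (at_right 0)" .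
  then have lim': "((\<lambda>h. sqrt (inverse (gap (rt s h) s / (rt s h - s)\<^sup>2))) \<longlongrightarrow> sqrt (inverse (f'' s / 2))) (at_right 0)"
    using pos[of s] s by (intro tendsto_real_sqrt tendsto_inverse) auto
  have "\<forall>\<^sub>F h in at_right 0. sqrt (inverse (gap (rt s h) s / (rt s h - s)\<^sup>2)) = (rt s h - s) / sqrt h"
    using small
  proof eventually_elim
    case (elim h)
    then have "gap (rt s h) s = h" "s < rt s h" using rt[of s h] rt_strict[of s h] s by auto
    then show ?case by (simp add: real_sqrt_divide)
  qed
  from tendsto_cong[OF this] have "((\<lambda>h. (rt s h - s) / sqrt h) \<longlongrightarrow> sqrt (inverse (f'' s / 2))) (at_right 0)"
    using lim' by blast
  then show ?thesis by simp
qed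

lemma lt_asymptotic:
  assumes s: "l < s" "s < r"
  shows "((\<lambda>h. (s - lt s h) / sqrt h) \<longlongrightarrow> sqrt (2 / f'' s)) (at_right 0)"
proof -
  interpret m: convex_graph "\<lambda>t. f (- t)" "\<lambda>t. - f' (- t)" "\<lambda>t. f'' (- t)" "- r" "- l" by (rule mirror)
  have g: "gap l s > 0" using gap_pos[of l s] s by auto
  have "\<forall>\<^sub>F h in at_right 0. h \<in> {0<..<gap l s}"
    using g by (auto simp: eventually_at_right_field)
  then have "\<forall>\<^sub>F h in at_right 0. (m.rt (- s) h - (- s)) / sqrt h = (s - lt s h) / sqrt h"
    by eventually_elim (use s in \<open>auto simp: mirror_rt\<close>)
  from tendsto_cong[OF this] show ?thesis using m.rt_asymptotic[of "- s"] s by simp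
qed

text \<open>Both half chords have the same leading term, so the curvature at the base point dictates
  the constant in the law.\<close>

lemma sqrt_width_constant:
  assumes s: "l < s" "s < r" and w: "sqrt_width s c H" "H > 0"
  shows "c = 2 * sqrt (2 / f'' s)"
proof -
  have g: "gap l s > 0" "gap r s > 0" using gap_pos[of l s] gap_pos[of r s] s by auto
  then have small: "\<forall>\<^sub>F h in at_right 0. h \<in> {0<..<Min {gap l s, gap r s, H}}"
    using w by (intro eventually_at_right_real) auto
  have "((\<lambda>h. (rt s h - s) / sqrt h + (s - lt s h) / sqrt h) \<longlongrightarrow> sqrt (2 / f'' s) + sqrt (2 / f'' s)) (at_right 0)"
    by (intro tendsto_add rt_asymptotic lt_asymptotic s)
  moreover have "\<forall>\<^sub>F h in at_right 0. (rt s h - s) / sqrt h + (s - lt s h) / sqrt h = c"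
    using small
  proof eventually_elim
    case (elim h)
    then have "rt s h - lt s h = c * sqrt h" using w s by (intro sqrt_widthD) auto
    moreover have "(rt s h - s) / sqrt h + (s - lt s h) / sqrt h = (rt s h - lt s h) / sqrt h"
      by (simp flip: add_divide_distrib)
    ultimately show ?case using elim by simp
  qed
  ultimately have "((\<lambda>h. c) \<longlongrightarrow> 2 * sqrt (2 / f'' s)) (at_right (0::real))" by (simp add: tendsto_cong)
  then show ?thesis by (simp add: tendsto_const_iff)
qed

text \<open>The right end of a short chord determines its left end, since the width is prescribed.\<close>

lemma extend_left:
  assumes s: "l < s" "s < r" and w: "sqrt_width s c H" "H > 0" and "e > 0"
    and "al \<noteq> 0" and par: "\<And>t. \<lbrakk>s \<le> t; t \<le> s + e; t \<le> r\<rbrakk> \<Longrightarrow> (al * (t - s) + be * gap t s)\<^sup>2 = ga * gap t s"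
  shows "\<exists>d>0. \<forall>t. s - d \<le> t \<and> t \<le> s \<longrightarrow> (al * (t - s) + be * gap t s)\<^sup>2 = ga * gap t s"
proof -
  \<comment> \<open>Dividing by \<open>al\<close> brings the equation into the sheared normal form
    \<open>al^2 * (x + k * y)^2 = ga * y\<close>.\<close>
  define k where "k = be / al"
  define q where "q = sqrt (2 / f'' s)"
  have q: "q > 0" unfolding q_def using pos[of s] s by auto
  have al_form: "(al * x + be * y)\<^sup>2 = al\<^sup>2 * (x + k * y)\<^sup>2" for x y
    using \<open>al \<noteq> 0\<close> unfolding k_def by (simp add: field_simps power2_eq_square)
  have g: "gap l s > 0" "gap r s > 0" "gap (min r (s + e)) s > 0"
    using gap_pos[of l s] gap_pos[of r s] gap_pos[of "min r (s + e)" s] s \<open>e > 0\<close> by (auto split: split_min)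
  then have small: "\<forall>\<^sub>F h in at_right 0. h \<in> {0<..<Min {gap l s, gap r s, H, gap (min r (s + e)) s}}"
    using w by (intro eventually_at_right_real) auto
  have lim: "((\<lambda>h. (rt s h - s) / sqrt h + k * sqrt h) \<longlongrightarrow> q) (at_right 0)"
  proof -
    have "((\<lambda>h. (rt s h - s) / sqrt h + k * sqrt h) \<longlongrightarrow> q + k * sqrt 0) (at_right 0)"
      unfolding q_def by (intro tendsto_intros rt_asymptotic s)
    then show ?thesis by simp
  qed
  have par': "al\<^sup>2 * ((rt s h - s) / sqrt h + k * sqrt h)\<^sup>2 = ga"
    if h: "h \<in> {0<..<Min {gap l s, gap r s, H, gap (min r (s + e)) s}}" for h
  proof -
    have b: "s \<le> rt s h" "rt s h \<le> r" "gap (rt s h) s = h" using rt[of s h] s h by auto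
    have "rt s h \<le> min r (s + e)"
    proof (rule ccontr)
      assume "\<not> ?thesis"
      then show False using gap_less_right[of s "min r (s + e)" "rt s h"] b s h \<open>e > 0\<close> by auto
    qed
    then have "al\<^sup>2 * (rt s h - s + k * h)\<^sup>2 = ga * h"
      using par[of "rt s h"] b by (simp add: al_form)
    moreover have "rt s h - s + k * h = sqrt h * ((rt s h - s) / sqrt h + k * sqrt h)"
      using h by (simp add: field_simps)
    ultimately show ?thesis using h by (simp add: power_mult_distrib)
  qed
  have "((\<lambda>h. al\<^sup>2 * ((rt s h - s) / sqrt h + k * sqrt h)\<^sup>2) \<longlongrightarrow> al\<^sup>2 * q\<^sup>2) (at_right 0)"
    by (intro tendsto_intros lim)
  moreover have "\<forall>\<^sub>F h in at_right 0. al\<^sup>2 * ((rt s h - s) / sqrt h + k * sqrt h)\<^sup>2 = ga"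
    using small by eventually_elim (rule par')
  ultimately have "((\<lambda>h. ga) \<longlongrightarrow> al\<^sup>2 * q\<^sup>2) (at_right (0::real))" by (simp add: tendsto_cong)
  \<comment> \<open>In the scale sqrt h the shear k h is of lower order, so the right ends alone
    force the coefficient of the parabola.\<close>
  then have ga: "ga = al\<^sup>2 * q\<^sup>2" by (simp add: tendsto_const_iff)
  \<comment> \<open>The equation determines only the square of this expression; its positive limit
    selects the root.\<close>
  have "\<forall>\<^sub>F h in at_right 0. h \<in> {0<..<Min {gap l s, gap r s, H, gap (min r (s + e)) s}} \<and>
      (rt s h - s) / sqrt h + k * sqrt h > 0"
    using small order_tendstoD(1)[OF lim q] by (rule eventually_conj)
  then obtain h1 where h1: "h1 > 0" "\<And>h. 0 < h \<Longrightarrow> h < h1 \<Longrightarrow>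
      h \<in> {0<..<Min {gap l s, gap r s, H, gap (min r (s + e)) s}} \<and> (rt s h - s) / sqrt h + k * sqrt h > 0"
    unfolding eventually_at_right_field by auto
  have left: "(lt s h - s + k * h)\<^sup>2 = q\<^sup>2 * h" if "0 < h" "h < h1" for h
  proof -
    have "((rt s h - s) / sqrt h + k * sqrt h)\<^sup>2 = q\<^sup>2"
      using par'[of h] h1(2)[of h] that \<open>al \<noteq> 0\<close> by (simp add: ga)
    then have "(rt s h - s) / sqrt h + k * sqrt h = q"
      using h1(2)[of h] that q by (simp add: power2_eq_iff)
    then have "rt s h - s + k * h = q * sqrt h" using that by (simp add: field_simps)
    \<comment> \<open>The sheared right end lies at q sqrt h and the width is 2 q sqrt h, so the
      sheared left end lies at -q sqrt h, which is the other root of the same quadratic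
      equation.\<close>
    moreover have "rt s h - lt s h = 2 * q * sqrt h"
      using sqrt_widthD[OF w(1) s, of h] h1(2)[of h] that sqrt_width_constant[OF s w] by (simp add: q_def)
    ultimately have "lt s h - s + k * h = - (q * sqrt h)" by simp
    then show ?thesis using that by (simp add: power_mult_distrib)
  qed
  \<comment> \<open>Half of \<open>h1\<close>, so that every point between \<open>t0\<close> and
    \<open>s\<close> has a gap strictly below \<open>h1\<close>.\<close>
  define t0 where "t0 = lt s (h1/2)"
  have t0: "l \<le> t0" "t0 < s" "gap t0 s = h1/2"
    using lt[of s "h1/2"] lt_strict[of s "h1/2"] h1(2)[of "h1/2"] h1(1) s by (auto simp: t0_def)
  show ?thesis
  proof (intro exI[of _ "s - t0"] conjI allI impI)
    fix t assume t: "s - (s - t0) \<le> t \<and> t \<le> s"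
    show "(al * (t - s) + be * gap t s)\<^sup>2 = ga * gap t s"
    proof (cases "t = s")
      case False
      have "gap t s \<le> h1/2" using gap_less_left[of t0 t s] t t0 s by (cases "t = t0") auto
      moreover have "gap t s > 0" using gap_pos[of t s] t t0 s False by auto
      ultimately have "(lt s (gap t s) - s + k * gap t s)\<^sup>2 = q\<^sup>2 * gap t s" using h1(1) by (intro left) auto
      moreover have "lt s (gap t s) = t" using t t0 s by (intro lt_eqI) auto
      ultimately show ?thesis by (simp add: al_form ga)
    qed simp
  qed (use t0 in auto)
qed

text \<open>The mirror image of \<open>extend_left\<close>: the reflection changes the sign of the
  linear term, hence \<open>- al\<close> in place of \<open>al\<close>.\<close>

lemma extend_right:
  assumes s: "l < s" "s < r" and w: "sqrt_width s c H" "H > 0" and "e > 0"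
    and "al \<noteq> 0" and par: "\<And>t. \<lbrakk>s - e \<le> t; t \<le> s; l \<le> t\<rbrakk> \<Longrightarrow> (al * (t - s) + be * gap t s)\<^sup>2 = ga * gap t s"
  shows "\<exists>d>0. \<forall>t. s \<le> t \<and> t \<le> s + d \<longrightarrow> (al * (t - s) + be * gap t s)\<^sup>2 = ga * gap t s"
proof -
  interpret m: convex_graph "\<lambda>t. f (- t)" "\<lambda>t. - f' (- t)" "\<lambda>t. f'' (- t)" "- r" "- l" by (rule mirror)
  have "\<exists>d>0. \<forall>t. - s - d \<le> t \<and> t \<le> - s \<longrightarrow> (- al * (t - - s) + be * m.gap t (- s))\<^sup>2 = ga * m.gap t (- s)"
  proof (rule m.extend_left[OF _ _ mirror_sqrt_width[OF w(1)] \<open>H > 0\<close> \<open>e > 0\<close>])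
    fix t assume "- s \<le> t" "t \<le> - s + e" "t \<le> - l"
    then show "(- al * (t - - s) + be * m.gap t (- s))\<^sup>2 = ga * m.gap t (- s)"
      using par[of "- t"] by (simp add: mirror_gap algebra_simps)
  qed (use s \<open>al \<noteq> 0\<close> in auto)
  then obtain d where d: "d > 0" "\<And>t. - s - d \<le> t \<Longrightarrow> t \<le> - s \<Longrightarrow>
      (- al * (t - - s) + be * gap (- t) s)\<^sup>2 = ga * gap (- t) s"
    by (auto simp: mirror_gap)
  show ?thesis
  proof (intro exI[of _ d] conjI allI impI)
    fix t assume "s \<le> t \<and> t \<le> s + d"
    then show "(al * (t - s) + be * gap t s)\<^sup>2 = ga * gap t s"
      using d(2)[of "- t"] by (simp add: algebra_simps)
  qed (rule d)
qed

text \<open>Writing \<open>b\<close> and \<open>a\<close> for the ends of the chord, both satisfy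
  \<open>\<partial>b/\<partial>s = f''(s) (b - s) \<partial>b/\<partial>h\<close>, so that the base-point derivative of the width
  is \<open>f''(s)/2\<close> times the height derivative of \<open>(b - s)\<^sup>2 - (a - s)\<^sup>2\<close>. Hence the midpoint of the
  chord moves linearly with the height.\<close>

lemma uniform_sqrt_width_imp_parabola:
  assumes s: "l < s" "s < r" and U: "open U" "s \<in> U" and H: "H > 0" "H \<le> gap l s" "H \<le> gap r s"
    and w: "\<And>s' h. \<lbrakk>s' \<in> U; 0 < h; h < H\<rbrakk> \<Longrightarrow> rt s' h - lt s' h = c s' * sqrt h"
  shows "\<exists>d>0. \<exists>be ga. s - d \<ge> l \<and> s + d \<le> r \<and>
    (\<forall>t\<in>{s-d..s+d}. ((t - s) + be * gap t s)\<^sup>2 = ga * gap t s)"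
proof -
  define h0 where "h0 = H/2"
  have h0: "0 < h0" "h0 < H" using H by (auto simp: h0_def)
  have ev: "\<forall>\<^sub>F s' in nhds s. s' \<in> U" using U by (rule eventually_nhds_in_open)
  define D where "D h = f'' s * (rt s h - s) / (f' (rt s h) - f' s) - f'' s * (lt s h - s) / (f' (lt s h) - f' s)" for h
  have D: "((\<lambda>s. rt s h - lt s h) has_real_derivative D h) (at s)" if "0 < h" "h < H" for h
    unfolding D_def using that H s by (intro DERIV_diff rt_deriv_base lt_deriv_base) auto
  define c' where "c' = D h0 / sqrt h0"
  \<comment> \<open>Nothing is known in advance about the dependence of \<open>c\<close> on the base
    point. Its differentiability is inherited from the width at the single height \<open>h0\<close>,
    which is a differentiable function of the base point.\<close>
  have "((\<lambda>s. (rt s h0 - lt s h0) / sqrt h0) has_real_derivative c') (at s)"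
    unfolding c'_def by (intro DERIV_cdivide D h0)
  moreover have "\<forall>\<^sub>F s' in nhds s. (rt s' h0 - lt s' h0) / sqrt h0 = c s'"
    using ev by eventually_elim (use w h0 in auto)
  ultimately have c': "(c has_real_derivative c') (at s)" by (subst (asm) DERIV_cong_ev[OF refl _ refl])
  have Deq: "D h = c' * sqrt h" if h: "0 < h" "h < H" for h
  proof -
    have "((\<lambda>s. c s * sqrt h) has_real_derivative c' * sqrt h) (at s)"
      by (rule DERIV_cmult_right[OF c'])
    moreover have "\<forall>\<^sub>F s' in nhds s. rt s' h - lt s' h = c s' * sqrt h"
      using ev by eventually_elim (use w h in auto)
    ultimately have "((\<lambda>s. rt s h - lt s h) has_real_derivative c' * sqrt h) (at s)"
      by (subst DERIV_cong_ev[OF refl _ refl])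
    with D[OF h] show ?thesis by (rule DERIV_unique)
  qed
  \<comment> \<open>The height derivative of the difference of squares is (2 / f''(s)) c' sqrt h;
    its primitive is K h sqrt h with K = (2/3) (2 / f''(s)) c'. Hence \<open>Q\<close> below has
    derivative zero, and it vanishes at height 0.\<close>
  define K where "K = 4 * c' / (3 * f'' s)"
  define Q where "Q h = (rt s h - s)\<^sup>2 - (lt s h - s)\<^sup>2 - K * (h * sqrt h)" for h
  have f2: "f'' s > 0" using pos[of s] s by auto
  have Q0: "Q 0 = 0" using rt_eqI[of s s 0] lt_eqI[of s s 0] s by (simp add: Q_def)
  have Q': "(Q has_real_derivative 0) (at h)" if h: "0 < h" "h < H" for h
  proof -
    have "(Q has_real_derivative (2 * ((rt s h - s) * inverse (f' (rt s h) - f' s)) - 2 * ((lt s h - s) * inverse (f' (lt s h) - f' s)))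
         - K * (h * (inverse (sqrt h) / 2) + sqrt h)) (at h)"
      unfolding Q_def using h H s
      by (auto intro!: derivative_eq_intros rt_deriv_height lt_deriv_height)
    moreover have "2 * ((rt s h - s) * inverse (f' (rt s h) - f' s)) - 2 * ((lt s h - s) * inverse (f' (lt s h) - f' s)) = 2 / f'' s * D h"
    proof -
      have "2 * x - 2 * y = 2 / f'' s * (f'' s * x - f'' s * y)" for x y
        using f2 by (simp add: field_simps)
      then show ?thesis unfolding D_def by (simp add: divide_inverse mult.assoc)
    qed
    moreover have "h * inverse (sqrt h) = sqrt h" using h by (simp add: field_simps)
    then have "h * (inverse (sqrt h) / 2) = sqrt h / 2" by simp
    then have "K * (h * (inverse (sqrt h) / 2) + sqrt h) = 2 / f'' s * (c' * sqrt h)"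
      unfolding K_def using f2 by (simp only:) (simp add: field_simps)
    ultimately show ?thesis by (simp add: Deq[OF h])
  qed
  have Q: "Q h = 0" if h: "0 < h" "h < H" for h
  proof -
    have "continuous_on {0..h} (rt s)" "continuous_on {0..h} (lt s)"
      using rt_continuous_on[of s] lt_continuous_on[of s] s h H by (auto intro: continuous_on_subset)
    then have "continuous_on {0..h} Q" unfolding Q_def by (intro continuous_intros)
    then have "Q h = Q 0" using Q' h by (intro DERIV_isconst2[of 0 h Q h]) auto
    then show ?thesis using Q0 by simp
  qed
  have cs: "c s > 0"
  proof -
    have "rt s h0 > s" "lt s h0 < s" using rt_strict[of s h0] lt_strict[of s h0] s h0 H by auto
    then have "c s * sqrt h0 > 0" using w[of s h0] U h0 by auto
    then show ?thesis using h0 by (simp add: zero_less_mult_iff)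
  qed
  define k where "k = K / c s"
  have ends_eq: "rt s h - s + - (k/2) * h = c s * sqrt h / 2 \<and> lt s h - s + - (k/2) * h = - c s * sqrt h / 2"
    if h: "0 < h" "h < H" for h
  proof -
    have w': "rt s h - lt s h = c s * sqrt h" using w U h by auto
    \<comment> \<open>The difference of squares is the width times twice the offset of the midpoint
      from \<open>s\<close>. Cancelling the width c sqrt h leaves an offset proportional to
      h.\<close>
    have "(rt s h - lt s h) * (rt s h + lt s h - 2 * s) = K * (h * sqrt h)"
      using Q[OF h] unfolding Q_def by (simp add: power2_eq_square algebra_simps)
    then have "sqrt h * (c s * (rt s h + lt s h - 2 * s)) = sqrt h * (K * h)"
      unfolding w' by (simp add: algebra_simps)
    then have "c s * (rt s h + lt s h - 2 * s) = K * h" using h by simp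
    then have "rt s h + lt s h - 2 * s = k * h" unfolding k_def using cs by (simp add: field_simps)
    then show ?thesis using w' by (simp add: field_simps)
  qed
  have main: "(rt s h - s + - (k/2) * h)\<^sup>2 = (c s)\<^sup>2 / 4 * h" "(lt s h - s + - (k/2) * h)\<^sup>2 = (c s)\<^sup>2 / 4 * h"
    if h: "0 < h" "h < H" for h
    unfolding ends_eq[OF h, THEN conjunct1] ends_eq[OF h, THEN conjunct2]
    using h by (auto simp: power_mult_distrib power_divide)
  \<comment> \<open>The distance from \<open>s\<close> to the nearer end of the chord at height
    \<open>h0\<close>; within it all gaps are at most \<open>h0\<close>, hence below
    \<open>H\<close>.\<close>
  define d where "d = min (rt s h0 - s) (s - lt s h0)"
  have ends: "s < rt s h0" "rt s h0 < r" "lt s h0 < s" "l < lt s h0"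
      "gap (rt s h0) s = h0" "gap (lt s h0) s = h0"
    using rt_strict[of s h0] lt_strict[of s h0] s h0 H rt[of s h0] lt[of s h0] by auto
  have "((t - s) + - (k/2) * gap t s)\<^sup>2 = (c s)\<^sup>2 / 4 * gap t s" if t: "t \<in> {s-d..s+d}" for t
  proof -
    have "lt s h0 \<le> t" "t \<le> rt s h0" using t by (auto simp: d_def)
    consider "t = s" | "s < t" | "t < s" by linarith
    then show ?thesis
    proof cases
      case 2
      have "gap t s \<le> h0" using gap_less_right[of s t "rt s h0"] ends 2 s \<open>t \<le> rt s h0\<close>
        by (cases "t = rt s h0") auto
      moreover have "gap t s > 0" using gap_pos[of t s] 2 s ends \<open>t \<le> rt s h0\<close> by auto
      moreover have "rt s (gap t s) = t" using 2 s ends \<open>t \<le> rt s h0\<close> by (intro rt_eqI) auto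
      ultimately show ?thesis using main(1)[of "gap t s"] h0 by auto
    next
      case 3
      have "gap t s \<le> h0" using gap_less_left[of "lt s h0" t s] ends 3 s \<open>lt s h0 \<le> t\<close>
        by (cases "t = lt s h0") auto
      moreover have "gap t s > 0" using gap_pos[of t s] 3 s ends \<open>lt s h0 \<le> t\<close> by auto
      moreover have "lt s (gap t s) = t" using 3 s ends \<open>lt s h0 \<le> t\<close> by (intro lt_eqI) auto
      ultimately show ?thesis using main(2)[of "gap t s"] h0 by auto
    qed simp
  qed
  moreover have "d > 0" "s - d \<ge> l" "s + d \<le> r" using ends by (auto simp: d_def)
  ultimately show ?thesis by blast
qed

text \<open>Both the constant and the admissible height vary with \<open>s\<close> without any
  control. Countably many closed sets, one for each bound H0 / (n + 1) on the height, cover an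
  interval of base points; one of them has interior, and there the uniform result applies.\<close>

lemma sqrt_width_imp_parabola_somewhere:
  assumes "l < r" and w: "\<And>s. \<lbrakk>l < s; s < r\<rbrakk> \<Longrightarrow> \<exists>c. \<exists>H>0. sqrt_width s c H"
  shows "\<exists>s d be ga. d > 0 \<and> s - d \<ge> l \<and> s + d \<le> r \<and>
    (\<forall>t\<in>{s-d..s+d}. ((t - s) + be * gap t s)\<^sup>2 = ga * gap t s)"
proof -
  \<comment> \<open>Restricting base points to the middle third keeps them away from
    \<open>l\<close> and \<open>r\<close>, so that the single height \<open>H0\<close> is available
    for all of them.\<close>
  define p where "p = l + (r - l) / 3"
  define q where "q = l + 2 * (r - l) / 3"
  have pq: "l < p" "p < q" "q < r" using \<open>l < r\<close> by (auto simp: p_def q_def field_simps)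
  define H0 where "H0 = min (gap r q) (gap l p)"
  have H0: "H0 > 0" using gap_pos[of r q] gap_pos[of l p] pq by (auto simp: H0_def)
  have H0_le: "H0 \<le> gap r s" "H0 \<le> gap l s" if "s \<in> {p..q}" for s
    using gap_anti_base[of s q r] gap_mono_base[of l p s] that pq by (auto simp: H0_def)
  define W where "W s h = rt s h - lt s h" for s h
  define I where "I n = {0<..<H0 / real (Suc n)}" for n
  have I: "h > 0 \<and> h < H0" if "h \<in> I n" for h n
  proof -
    have "H0 / real (Suc n) \<le> H0" using H0 by (simp add: field_simps)
    then show ?thesis using that by (auto simp: I_def)
  qed
  \<comment> \<open>Cross-multiplication eliminates the unknown constant of \<open>s\<close>. For
    fixed heights what remains is an equation between continuous functions of \<open>s\<close>, so
    \<open>E n\<close> is closed.\<close>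
  define E where "E n = {s \<in> {p..q}. \<forall>h\<in>I n. \<forall>h'\<in>I n. W s h * sqrt h' = W s h' * sqrt h}" for n
  have W_cont: "continuous_on {p..q} (\<lambda>s. W s h)" if "0 < h" "h < H0" for h
  proof (rule continuous_at_imp_continuous_on, rule ballI)
    fix s assume s: "s \<in> {p..q}"
    show "isCont (\<lambda>s. W s h) s" unfolding W_def
      using DERIV_isCont[OF rt_deriv_base[of s h]] DERIV_isCont[OF lt_deriv_base[of s h]] s pq that H0_le[OF s]
      by (intro continuous_intros) auto
  qed
  have E_closed: "closed (E n)" for n
  proof -
    have "closed {s \<in> {p..q}. W s h * sqrt h' - W s h' * sqrt h = 0}" if "h \<in> I n" "h' \<in> I n" for h h'
      using that by (intro continuous_closed_preimage_constant continuous_intros W_cont) (auto dest: I)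
    moreover have "E n = {p..q} \<inter> (\<Inter>h\<in>I n. \<Inter>h'\<in>I n. {s \<in> {p..q}. W s h * sqrt h' - W s h' * sqrt h = 0})"
      by (auto simp: E_def)
    ultimately show ?thesis by (auto intro!: closed_Int closed_INT)
  qed
  have E_cover: "\<exists>n. s \<in> E n" if s: "s \<in> {p..q}" for s
  proof -
    obtain c H where H: "H > 0" "sqrt_width s c H" using w[of s] s pq by auto
    obtain n where n: "inverse (real (Suc n)) < H / H0" using reals_Archimedean[of "H / H0"] H H0 by auto
    have "W s h = c * sqrt h" if "h \<in> I n" for h
    proof -
      have "h < H0 / real (Suc n)" using that by (auto simp: I_def)
      also have "\<dots> < H" using n H0 by (simp add: field_simps)
      finally show ?thesis unfolding W_def
        using I[OF that] H0_le[OF s] s pq by (intro sqrt_widthD[OF H(2)]) auto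
    qed
    then have "s \<in> E n" using s by (auto simp: E_def)
    then show ?thesis ..
  qed
  have "\<exists>n. \<not> {p..q} \<subseteq> closure ({p..q} - E n)"
  proof (rule ccontr)
    assume "\<not> ?thesis"
    then have dense: "{p..q} \<subseteq> closure ({p..q} - E n)" for n by blast
    have "{p..q} \<subseteq> closure (\<Inter>(range (\<lambda>n. {p..q} - E n)))"
    proof (rule Baire)
      fix T assume "T \<in> range (\<lambda>n. {p..q} - E n)"
      then obtain n where T: "T = {p..q} - E n" by auto
      have "openin (top_of_set {p..q}) ({p..q} \<inter> - E n)"
        using E_closed[of n] by (intro openin_open_Int) auto
      then show "openin (top_of_set {p..q}) T \<and> {p..q} \<subseteq> closure T"
        using dense[of n] T by (auto simp: Diff_eq)
    qed auto
    moreover have "\<Inter>(range (\<lambda>n. {p..q} - E n)) = {}" using E_cover by auto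
    ultimately have "{p..q} \<subseteq> {}" by (simp only: closure_empty)
    then show False using pq by auto
  qed
  then obtain n where "\<not> {p..q} \<subseteq> closure ({p..q} - E n)" ..
  then obtain x where x: "x \<in> {p..q}" "x \<notin> closure ({p..q} - E n)" by blast
  define U where "U = - closure ({p..q} - E n) \<inter> {p<..<q}"
  have "open U" unfolding U_def by (intro open_Int) auto
  \<comment> \<open>The point \<open>x\<close> may be an end of the interval, but its neighbourhood
    still meets the open interval, because \<open>x\<close> lies in the closure of the
    latter.\<close>
  have "x \<in> - closure ({p..q} - E n) \<inter> closure {p<..<q}" using x pq by simp
  then have "U \<noteq> {}"
    unfolding U_def using open_Int_closure_eq_empty[of "- closure ({p..q} - E n)" "{p<..<q}"] by blast
  then obtain s where s: "s \<in> U" by auto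
  have UE: "s' \<in> E n" if "s' \<in> U" for s'
    using that subsetD[OF closure_subset, of s' "{p..q} - E n"] by (auto simp: U_def)
  define H where "H = H0 / real (Suc n)"
  have H: "H > 0" using H0 by (simp add: H_def)
  have IH: "h \<in> I n \<longleftrightarrow> 0 < h \<and> h < H" for h by (auto simp: I_def H_def)
  have HH0: "H \<le> H0" using H0 by (simp add: H_def field_simps)
  have spq: "p < s" "s < q" using s by (auto simp: U_def)
  have "\<exists>d>0. \<exists>be ga. s - d \<ge> l \<and> s + d \<le> r \<and>
    (\<forall>t\<in>{s-d..s+d}. ((t - s) + be * gap t s)\<^sup>2 = ga * gap t s)"
  \<comment> \<open>The constant at \<open>s'\<close> is read off from the chord at height H/2,
    which is admissible for every base point of \<open>U\<close>.\<close>
  proof (rule uniform_sqrt_width_imp_parabola[of s U H "\<lambda>s'. W s' (H/2) / sqrt (H/2)"])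
    fix s' h assume *: "s' \<in> U" "0 < h" "h < H"
    have "W s' h * sqrt (H/2) = W s' (H/2) * sqrt h"
      using UE[OF *(1)] * H by (simp add: E_def IH)
    then show "rt s' h - lt s' h = W s' (H/2) / sqrt (H/2) * sqrt h"
      using H by (simp add: W_def field_simps)
  qed (use s spq pq \<open>open U\<close> H H0_le[of s] HH0 in auto)
  then show ?thesis by blast
qed

end

section \<open>Orthonormal frames and centroids in the plane\<close>

lemma inner_vec2: "(v::real^2) \<bullet> w = v $ 1 * w $ 1 + v $ 2 * w $ 2"
  by (simp add: inner_vec_def sum_2)

text \<open>No orientation is imposed, so tangent and normal may exchange roles.\<close>

locale orthonormal_frame =
  fixes e1 e2 :: "real^2"
  assumes norm1: "norm e1 = 1" and norm2: "norm e2 = 1" and orth: "e1 \<bullet> e2 = 0"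
begin

lemma inner_frame [simp]: "e1 \<bullet> e1 = 1" "e2 \<bullet> e2 = 1" "e1 \<bullet> e2 = 0" "e2 \<bullet> e1 = 0"
  using norm1 norm2 orth by (auto simp: norm_eq_1 inner_commute)

lemma orthogonal_zero:
  assumes "w \<bullet> e1 = 0" "w \<bullet> e2 = 0" shows "w = 0"
proof -
  define D where "D = e1 $ 1 * e2 $ 2 - e1 $ 2 * e2 $ 1"
  \<comment> \<open>Lagrange's identity: the squared determinant is the Gram determinant, here
    1.\<close>
  have "D\<^sup>2 = (e1 \<bullet> e1) * (e2 \<bullet> e2) - (e1 \<bullet> e2)\<^sup>2"
    unfolding D_def inner_vec2 by (simp add: power2_eq_square algebra_simps)
  then have "D \<noteq> 0" by auto
  have "w $ 1 * D = (w \<bullet> e1) * e2 $ 2 - (w \<bullet> e2) * e1 $ 2"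
       "w $ 2 * D = (w \<bullet> e2) * e1 $ 1 - (w \<bullet> e1) * e2 $ 1"
    unfolding D_def inner_vec2 by (simp_all add: algebra_simps)
  then have "w $ 1 = 0" "w $ 2 = 0" using assms \<open>D \<noteq> 0\<close> by auto
  then show ?thesis by (simp add: vec_eq_iff forall_2)
qed

lemma expand: "v = (v \<bullet> e1) *\<^sub>R e1 + (v \<bullet> e2) *\<^sub>R e2"
proof -
  have "v - ((v \<bullet> e1) *\<^sub>R e1 + (v \<bullet> e2) *\<^sub>R e2) = 0"
    by (rule orthogonal_zero) (simp_all add: inner_diff_left inner_add_left)
  then show ?thesis by simp
qed

lemma eqI: "\<lbrakk>v \<bullet> e1 = w \<bullet> e1; v \<bullet> e2 = w \<bullet> e2\<rbrakk> \<Longrightarrow> v = w"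
  using orthogonal_zero[of "v - w"] by (simp add: inner_diff_left)

lemma norm_sq: "(norm v)\<^sup>2 = (v \<bullet> e1)\<^sup>2 + (v \<bullet> e2)\<^sup>2"
  by (subst expand) (simp only: power2_norm_eq_inner, simp add: inner_add_left inner_add_right power2_eq_square)

lemma swap: "orthonormal_frame e2 e1"
  by unfold_locales (use norm1 norm2 in \<open>auto\<close>)

lemma line_eq_hyperplane: "{P + c *\<^sub>R e1 | c. True} = {p. (p - P) \<bullet> e2 = 0}"
proof (intro set_eqI iffI)
  fix p assume "p \<in> {p. (p - P) \<bullet> e2 = 0}"
  then have "p = P + ((p - P) \<bullet> e1) *\<^sub>R e1" using expand[of "p - P"] by (simp add: algebra_simps)
  then show "p \<in> {P + c *\<^sub>R e1 | c. True}" by blast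
qed (auto simp: inner_diff_left inner_add_left)

lemma infdist_hyperplane: "infdist p {q. (q - P) \<bullet> e2 = 0} = \<bar>(p - P) \<bullet> e2\<bar>"
proof (rule antisym)
  let ?q = "p - ((p - P) \<bullet> e2) *\<^sub>R e2"
  have "?q \<in> {q. (q - P) \<bullet> e2 = 0}" by (simp add: inner_diff_left)
  then have "infdist p {q. (q - P) \<bullet> e2 = 0} \<le> dist p ?q" by (rule infdist_le)
  also have "dist p ?q = \<bar>(p - P) \<bullet> e2\<bar>" by (simp add: dist_norm norm2)
  finally show "infdist p {q. (q - P) \<bullet> e2 = 0} \<le> \<bar>(p - P) \<bullet> e2\<bar>" .
next
  have "P \<in> {q. (q - P) \<bullet> e2 = 0}" by simp
  then show "\<bar>(p - P) \<bullet> e2\<bar> \<le> infdist p {q. (q - P) \<bullet> e2 = 0}"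
  proof (subst infdist_notempty, blast, intro cINF_greatest)
    fix q assume "q \<in> {q. (q - P) \<bullet> e2 = 0}"
    then have "(p - P) \<bullet> e2 = (p - q) \<bullet> e2" by (simp add: inner_diff_left)
    then show "\<bar>(p - P) \<bullet> e2\<bar> \<le> dist p q"
      using Cauchy_Schwarz_ineq2[of "p - q" e2] by (simp add: dist_norm norm2)
  qed blast
qed

lemma orthogonal_transformation_frame:
  "orthogonal_transformation (\<lambda>v::real^2. v $ 1 *\<^sub>R e1 + v $ 2 *\<^sub>R e2)"
  "orthogonal_transformation (\<lambda>p. vector [p \<bullet> e1, p \<bullet> e2] :: real^2)"
proof -
  show "orthogonal_transformation (\<lambda>v::real^2. v $ 1 *\<^sub>R e1 + v $ 2 *\<^sub>R e2)"
    unfolding orthogonal_transformation_def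
  proof (intro conjI allI)
    fix v w :: "real^2"
    show "(v $ 1 *\<^sub>R e1 + v $ 2 *\<^sub>R e2) \<bullet> (w $ 1 *\<^sub>R e1 + w $ 2 *\<^sub>R e2) = v \<bullet> w"
      by (simp add: inner_add_left inner_add_right inner_vec2[of v w])
  qed (auto intro!: linearI simp: algebra_simps)
  show "orthogonal_transformation (\<lambda>p. vector [p \<bullet> e1, p \<bullet> e2] :: real^2)"
    unfolding orthogonal_transformation_def
  proof (intro conjI allI)
    show "linear (\<lambda>p. vector [p \<bullet> e1, p \<bullet> e2] :: real^2)"
      by (intro linearI) (auto simp: vec_eq_iff forall_2 inner_add_left)
    fix v w :: "real^2"
    have "v \<bullet> w = ((v \<bullet> e1) *\<^sub>R e1 + (v \<bullet> e2) *\<^sub>R e2) \<bullet> ((w \<bullet> e1) *\<^sub>R e1 + (w \<bullet> e2) *\<^sub>R e2)"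
      using expand[of v] expand[of w] by simp
    then show "(vector [v \<bullet> e1, v \<bullet> e2] :: real^2) \<bullet> vector [w \<bullet> e1, w \<bullet> e2] = v \<bullet> w"
      by (simp add: inner_vec2[of "vector _"] inner_add_left inner_add_right)
  qed
qed

end

text \<open>Fubini's theorem concerns product types while the plane is a vector type; identifying
  the two measures on boxes provides the bridge.\<close>

lemma distr_pair_vec2:
  "distr lborel borel (\<lambda>z::real\<times>real. fst z *\<^sub>R axis 1 1 + snd z *\<^sub>R axis 2 1) = (lborel :: (real^2) measure)"
  (is "distr lborel borel ?F = _")
proof (rule lborel_eqI[symmetric])
  have [measurable]: "?F \<in> borel_measurable borel"
    by (intro borel_measurable_continuous_onI continuous_intros)
  fix l u :: "real^2" assume lu: "\<And>b. b \<in> Basis \<Longrightarrow> l \<bullet> b \<le> u \<bullet> b"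
  have F: "?F z $ 1 = fst z" "?F z $ 2 = snd z" for z by (auto simp: axis_def)
  have lu': "l $ i \<le> u $ i" for i using lu[of "axis i 1"] by (simp add: cart_eq_inner_axis)
  have "emeasure (distr lborel borel ?F) (box l u) = emeasure lborel (?F -` box l u)"
    by (subst emeasure_distr) auto
  also have "?F -` box l u = {l$1<..<u$1} \<times> {l$2<..<u$2}"
    by (auto simp: mem_box_cart forall_2 axis_def)
  also have "emeasure lborel \<dots> = emeasure (lborel \<Otimes>\<^sub>M lborel) ({l$1<..<u$1} \<times> {l$2<..<u$2})"
    by (simp add: lborel_prod)
  also have "\<dots> = ennreal (u$1 - l$1) * ennreal (u$2 - l$2)"
    using lu' by (subst lborel.emeasure_pair_measure_Times) auto
  also have "\<dots> = ennreal ((u$1 - l$1) * (u$2 - l$2))"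
    using lu' by (simp add: ennreal_mult)
  also have "(u$1 - l$1) * (u$2 - l$2) = (\<Prod>b\<in>Basis. (u - l) \<bullet> b)"
    by (simp add: Basis_vec_def cart_eq_inner_axis axis_eq_axis prod.UNION_disjoint UNIV_2 inner_diff_left mult.commute)
  finally show "emeasure (distr lborel borel ?F) (box l u) = (\<Prod>b\<in>Basis. (u - l) \<bullet> b)" .
qed simp

context orthonormal_frame begin

text \<open>The preimage of a box under the frame map is its image under the inverse orthogonal map,
  which preserves measure, and boxes determine Lebesgue measure.\<close>

lemma distr_frame_vec:
  "distr lborel borel (\<lambda>v::real^2. v $ 1 *\<^sub>R e1 + v $ 2 *\<^sub>R e2) = lborel" (is "distr lborel borel ?f = _")
proof (rule lborel_eqI[symmetric])
  fix l u :: "real^2" assume lu: "\<And>b. b \<in> Basis \<Longrightarrow> l \<bullet> b \<le> u \<bullet> b"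
  let ?g = "\<lambda>p. vector [p \<bullet> e1, p \<bullet> e2] :: real^2"
  have fg: "?f (?g p) = p" for p using expand[of p] by simp
  have gf: "?g (?f v) = v" for v by (simp add: vec_eq_iff forall_2 inner_add_left)
  have im: "?g ` box l u = ?f -` box l u"
  proof (intro set_eqI iffI)
    fix v assume "v \<in> ?f -` box l u"
    then show "v \<in> ?g ` box l u" using gf[of v] by (intro image_eqI[of _ _ "?f v"]) auto
  qed (use fg in auto)
  have meas [measurable]: "?f \<in> borel_measurable borel"
    by (intro borel_measurable_continuous_onI continuous_intros)
  have "emeasure (distr lborel borel ?f) (box l u) = emeasure lborel (?f -` box l u)"
    by (subst emeasure_distr) auto
  also have "\<dots> = emeasure lebesgue (?f -` box l u)"
  proof -
    have "?f -` box l u \<in> sets borel" using measurable_sets[OF meas, of "box l u"] by simp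
    then show ?thesis by simp
  qed
  also have "\<dots> = measure lebesgue (?g ` box l u)"
    unfolding im[symmetric] using measurable_orthogonal_image[OF orthogonal_transformation_frame(2), of "box l u"]
    by (auto simp: emeasure_eq_measure2)
  also have "\<dots> = measure lebesgue (box l u)"
    by (simp add: measure_orthogonal_image[OF orthogonal_transformation_frame(2)])
  also have "\<dots> = (\<Prod>b\<in>Basis. (u - l) \<bullet> b)"
    using lu by (simp add: measure_lborel_box_eq inner_diff_left)
  finally show "emeasure (distr lborel borel ?f) (box l u) = (\<Prod>b\<in>Basis. (u - l) \<bullet> b)" .
qed simp

lemma distr_frame:
  "distr lborel borel (\<lambda>z::real\<times>real. P + (fst z *\<^sub>R e1 + snd z *\<^sub>R e2)) = lborel"
proof -
  let ?F = "\<lambda>z::real\<times>real. fst z *\<^sub>R axis 1 1 + snd z *\<^sub>R axis 2 1 :: real^2"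
  let ?f = "\<lambda>v::real^2. v $ 1 *\<^sub>R e1 + v $ 2 *\<^sub>R e2"
  have [measurable]: "?f \<in> borel_measurable borel"
    by (intro borel_measurable_continuous_onI continuous_intros)
  have [measurable]: "?F \<in> borel_measurable borel"
    by (intro borel_measurable_continuous_onI continuous_intros)
  have "lborel = distr (distr (distr lborel borel ?F) borel ?f) borel ((+) P)"
    by (simp only: distr_pair_vec2 distr_frame_vec lborel_distr_plus)
  also have "\<dots> = distr lborel borel ((+) P \<circ> (?f \<circ> ?F))"
    by (subst (1 2) distr_distr) (auto simp: o_assoc)
  also have "(+) P \<circ> (?f \<circ> ?F) = (\<lambda>z. P + (fst z *\<^sub>R e1 + snd z *\<^sub>R e2))"
    by (auto simp: axis_def fun_eq_iff)
  finally show ?thesis by simp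
qed

text \<open>Cavalieri's principle: Fubini in the frame coordinates, with the weight depending only
  on the outer variable, which runs along \<open>e1\<close>. It will be applied to the exchanged
  frame, where the outer direction is the normal and the slices are parallel to the tangent.\<close>

lemma integral_slices:
  assumes R: "open R" "bounded R" and h: "0 < h"
    and slices: "\<And>x y. P + (y *\<^sub>R e1 + x *\<^sub>R e2) \<in> R \<longleftrightarrow> 0 < y \<and> y < h \<and> A y < x \<and> x < B y"
    and AB: "\<And>y. \<lbrakk>0 < y; y < h\<rbrakk> \<Longrightarrow> A y \<le> B y"
    and cont: "continuous_on {0..h} (\<lambda>y. B y - A y)" "continuous_on UNIV k"
  shows "(LINT p:R|lebesgue. k ((p - P) \<bullet> e1)) = integral {0..h} (\<lambda>y. k y * (B y - A y))"
proof -
  let ?F = "\<lambda>z::real\<times>real. P + (fst z *\<^sub>R e1 + snd z *\<^sub>R e2)"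
  let ?G = "\<lambda>p. indicator R p *\<^sub>R k ((p - P) \<bullet> e1)"
  have [measurable]: "R \<in> sets borel" "k \<in> borel_measurable borel"
    using R cont by (auto intro: borel_measurable_continuous_onI)
  obtain c r where r: "R \<subseteq> cball c r" using \<open>bounded R\<close> by (meson bounded_subset_cball)
  have "set_integrable lborel (cball c r) (\<lambda>p. k ((p - P) \<bullet> e1))"
    unfolding set_integrable_def
    by (intro borel_integrable_compact continuous_on_compose2[OF cont(2)] continuous_intros) auto
  then have "set_integrable lborel R (\<lambda>p. k ((p - P) \<bullet> e1))"
    by (rule set_integrable_subset) (use r in auto)
  then have G: "integrable lborel ?G" unfolding set_integrable_def .
  have F [measurable]: "?F \<in> measurable lborel borel"
    by (simp, intro borel_measurable_continuous_onI continuous_intros)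
  have Gm: "?G \<in> borel_measurable borel" by measurable
  have FG: "integrable lborel (\<lambda>z. ?G (?F z))"
    using G integrable_distr_eq[OF F Gm] by (simp only: distr_frame)
  have "(LINT p:R|lebesgue. k ((p - P) \<bullet> e1)) = (LINT p|lborel. ?G p)"
    unfolding set_lebesgue_integral_def by (simp add: integral_completion)
  also have "\<dots> = (LINT z|lborel. ?G (?F z))"
    using integral_distr[OF F Gm] by (simp only: distr_frame)
  also have "\<dots> = (LINT y|lborel. LINT x|lborel. ?G (?F (y, x)))"
    using lborel_pair.integral_fst'[of "\<lambda>z. ?G (?F z)"] FG by (simp add: lborel_prod)
  also have "\<dots> = (LINT y|lborel. indicator {0<..<h} y *\<^sub>R (k y * (B y - A y)))"
  proof (intro Bochner_Integration.integral_cong refl)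
    fix y :: real
    have "?G (?F (y, x)) = (indicator {0<..<h} y * k y) * indicator {A y<..<B y} x" for x
      by (auto simp: slices inner_add_left split: split_indicator)
    then have "(LINT x|lborel. ?G (?F (y, x))) = indicator {0<..<h} y * k y * measure lborel {A y<..<B y}"
      by simp
    also have "\<dots> = indicator {0<..<h} y *\<^sub>R (k y * (B y - A y))"
      using AB[of y] by (auto split: split_indicator)
    finally show "(LINT x|lborel. ?G (?F (y, x))) = \<dots>" .
  qed
  also have "\<dots> = integral {0<..<h} (\<lambda>y. k y * (B y - A y))"
  proof -
    have "set_integrable lborel {0..h} (\<lambda>y. k y * (B y - A y))"
      unfolding set_integrable_def
      by (intro borel_integrable_compact continuous_on_mult continuous_on_subset[OF cont(2)] cont(1)) auto
    then have "set_integrable lborel {0<..<h} (\<lambda>y. k y * (B y - A y))"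
      by (rule set_integrable_subset) auto
    from set_borel_integral_eq_integral(2)[OF this] show ?thesis
      unfolding set_lebesgue_integral_def .
  qed
  also have "\<dots> = integral {0..h} (\<lambda>y. k y * (B y - A y))"
    by (rule integral_open_interval_real[symmetric])
  finally show ?thesis .
qed

lemma centroid_component:
  assumes R: "open R" "bounded R" and m: "measure lebesgue R \<noteq> 0"
  shows "(centroid R - P) \<bullet> e1 = (LINT p:R|lebesgue. (p - P) \<bullet> e1) / (LINT p:R|lebesgue. 1)"
proof -
  obtain c r where r: "R \<subseteq> cball c r" using \<open>bounded R\<close> by (meson bounded_subset_cball)
  have [measurable]: "R \<in> sets borel" using R by auto
  have int: "set_integrable lebesgue R f" if "continuous_on UNIV f" for f :: "real^2 \<Rightarrow> 'b::euclidean_space"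
  proof -
    have "set_integrable lborel (cball c r) f"
      unfolding set_integrable_def using that
      by (intro borel_integrable_compact) (auto intro: continuous_on_subset)
    then have "set_integrable lborel R f"
      by (rule set_integrable_subset) (use r in auto)
    moreover have "f \<in> borel_measurable borel" using that by (rule borel_measurable_continuous_onI)
    ultimately show ?thesis unfolding set_integrable_def
      by (subst integrable_completion) auto
  qed
  have one: "(LINT p:R|lebesgue. 1) = measure lebesgue R"
    unfolding set_lebesgue_integral_def by simp
  have "(LINT p:R|lebesgue. p) \<bullet> e1 = (LINT p:R|lebesgue. p \<bullet> e1)"
    using integral_inner_left[of e1 lebesgue "\<lambda>p. indicator R p *\<^sub>R p"] int[of "\<lambda>p. p"]
    unfolding set_lebesgue_integral_def set_integrable_def by (simp add: continuous_on_id)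
  moreover have "(LINT p:R|lebesgue. (p - P) \<bullet> e1) = (LINT p:R|lebesgue. p \<bullet> e1) - (LINT p:R|lebesgue. P \<bullet> e1)"
    unfolding inner_diff_left by (intro set_integral_diff int continuous_intros)
  moreover have "(LINT p:R|lebesgue. P \<bullet> e1) = measure lebesgue R * (P \<bullet> e1)"
    unfolding set_lebesgue_integral_def by simp
  ultimately show ?thesis using m unfolding one centroid_def
    by (simp add: inner_diff_left field_simps)
qed

end

section \<open>The section cut off by a chord\<close>

text \<open>\<open>P\<close> is the origin and \<open>e1\<close> the tangent direction there, so the
  gap over the base point 0 is \<open>f\<close> itself and chords at \<open>P\<close> are level sets
  of \<open>f\<close>.\<close>

locale framed_graph = convex_graph f f' f'' l r + orthonormal_frame e1 e2
  for f f' f'' l r e1 e2 +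
  fixes P :: "real^2"
  assumes bounds: "l < 0" "0 < r" and vertex: "f 0 = 0" "f' 0 = 0"
begin

definition pt :: "real \<Rightarrow> real^2" where "pt t = P + (t *\<^sub>R e1 + f t *\<^sub>R e2)"

lemma gap0 [simp]: "gap t 0 = f t"
  by (simp add: gap_def vertex)

lemma pt_inner [simp]: "(pt t - P) \<bullet> e1 = t" "(pt t - P) \<bullet> e2 = f t"
  by (auto simp: pt_def inner_add_left)

text \<open>The graph lies above its tangent at the intermediate point \<open>m\<close>; averaging
  the two gaps over \<open>m\<close> cancels the linear term.\<close>

lemma convex_ineq:
  assumes "a \<in> {l..r}" "b \<in> {l..r}" "0 \<le> u" "0 \<le> v" "u + v = 1"
  shows "f (u * a + v * b) \<le> u * f a + v * f b"
proof -
  define m where "m = u * a + v * b"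
  have "m \<in> {l..r}" using convexD[of "{l..r}" a b u v] assms by (simp add: m_def)
  then have "0 \<le> u * gap a m + v * gap b m"
    using assms gap_nonneg by (intro add_nonneg_nonneg mult_nonneg_nonneg) auto
  also have "\<dots> = u * f a + v * f b - (u + v) * f m - f' m * (u * a + v * b - (u + v) * m)"
    by (simp add: gap_def algebra_simps)
  finally show ?thesis using assms by (simp add: m_def)
qed

context
  fixes h a b assumes h: "0 < h" "h < f l" "h < f r"
  defines "a \<equiv> lt 0 h" and "b \<equiv> rt 0 h"
begin

lemma ends: "l < a" "a < 0" "0 < b" "b < r" "f a = h" "f b = h"
  using rt_strict[of 0 h] lt_strict[of 0 h] rt[of 0 h] lt[of 0 h] bounds h by (auto simp: a_def b_def)

lemma below_chord: "a < t \<Longrightarrow> t < b \<Longrightarrow> f t < h"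
  using gap_less_right[of 0 t b] gap_less_left[of a t 0] ends bounds h by (cases "t \<ge> 0") auto

text \<open>The closed region \<open>K\<close> between arc and chord is convex and bounded, and its
  frontier is arc plus chord. The inside of the frontier of such a set is its interior, so the
  Jordan curve theorem is not called upon.\<close>

lemma section_eq:
  "inside (pt ` {a..b} \<union> closed_segment (pt a) (pt b)) =
     {p. a < (p - P) \<bullet> e1 \<and> (p - P) \<bullet> e1 < b \<and> f ((p - P) \<bullet> e1) < (p - P) \<bullet> e2 \<and> (p - P) \<bullet> e2 < h}"
  "open (inside (pt ` {a..b} \<union> closed_segment (pt a) (pt b)))"
  "bounded (inside (pt ` {a..b} \<union> closed_segment (pt a) (pt b)))"
proof -
  define x where "x p = (p - P) \<bullet> e1" for p
  define y where "y p = (p - P) \<bullet> e2" for p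
  define K where "K = {p. a \<le> x p \<and> x p \<le> b \<and> f (x p) \<le> y p \<and> y p \<le> h}"
  define Q where "Q = {p. a < x p \<and> x p < b \<and> f (x p) < y p \<and> y p < h}"
  have xy_cont: "continuous_on UNIV x" "continuous_on UNIV y"
    unfolding x_def y_def by (intro continuous_intros)+
  \<comment> \<open>Clamping the abscissa to [a, b] gives a function continuous on the whole line
    that agrees with \<open>f\<close> where it matters, so closedness and openness follow from
    global continuity.\<close>
  define g where "g u = f (max a (min b u))" for u
  have "continuous_on {a..b} f"
    using gap_continuous[of "{a..b}" 0] ends by auto
  then have "continuous_on UNIV g" unfolding g_def
    by (rule continuous_on_compose2) (use ends in \<open>auto intro!: continuous_intros\<close>)
  then have g: "continuous_on UNIV (\<lambda>p. g (x p))"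
    by (rule continuous_on_compose2) (auto intro: xy_cont)
  have Kg: "K = {p. a \<le> x p} \<inter> {p. x p \<le> b} \<inter> {p. g (x p) \<le> y p} \<inter> {p. y p \<le> h}"
    by (auto simp: K_def g_def)
  have Qg: "Q = {p. a < x p} \<inter> {p. x p < b} \<inter> {p. g (x p) < y p} \<inter> {p. y p < h}"
    by (auto simp: Q_def g_def)
  have "closed K" unfolding Kg
    by (intro closed_Int closed_Collect_le xy_cont g continuous_intros)
  have "open Q" unfolding Qg
    by (intro open_Int open_Collect_less xy_cont g continuous_intros)
  have "convex K"
    unfolding convex_def
  proof (intro ballI allI impI)
    fix p q u v assume *: "p \<in> K" "q \<in> K" "0 \<le> (u::real)" "0 \<le> v" "u + v = 1"
    have xy: "x (u *\<^sub>R p + v *\<^sub>R q) = u * x p + v * x q" "y (u *\<^sub>R p + v *\<^sub>R q) = u * y p + v * y q"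
    proof -
      have "u *\<^sub>R p + v *\<^sub>R q - P = u *\<^sub>R (p - P) + v *\<^sub>R (q - P)"
        using *(5) by (simp add: algebra_simps flip: scaleR_left_distrib)
      then show "x (u *\<^sub>R p + v *\<^sub>R q) = u * x p + v * x q" "y (u *\<^sub>R p + v *\<^sub>R q) = u * y p + v * y q"
        by (simp_all add: x_def y_def inner_add_left)
    qed
    have "u * x p + v * x q \<in> {a..b}" "u * y p + v * y q \<in> {..h}"
      using convexD[of "{a..b}" "x p" "x q" u v] convexD[of "{..h}" "y p" "y q" u v] * by (auto simp: K_def)
    moreover have "f (u * x p + v * x q) \<le> u * f (x p) + v * f (x q)"
      using * ends by (intro convex_ineq) (auto simp: K_def)
    moreover have "u * f (x p) + v * f (x q) \<le> u * y p + v * y q"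
      using * by (intro add_mono mult_left_mono) (auto simp: K_def)
    ultimately show "u *\<^sub>R p + v *\<^sub>R q \<in> K" by (auto simp: K_def xy)
  qed
  have "bounded K"
  proof -
    have "K \<subseteq> cball P (\<bar>a\<bar> + \<bar>b\<bar> + h)"
    proof
      fix p assume p: "p \<in> K"
      then have "0 \<le> f (x p)" using gap_nonneg[of "x p" 0] ends bounds by (auto simp: K_def)
      then have "\<bar>x p\<bar> \<le> \<bar>a\<bar> + \<bar>b\<bar>" "\<bar>y p\<bar> \<le> h" using p by (auto simp: K_def)
      moreover have "norm (p - P) \<le> norm (x p *\<^sub>R e1) + norm (y p *\<^sub>R e2)"
        by (subst expand[of "p - P"]) (simp only: x_def y_def norm_triangle_ineq)
      ultimately show "p \<in> cball P (\<bar>a\<bar> + \<bar>b\<bar> + h)"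
        by (simp add: dist_norm norm_minus_commute norm1 norm2)
    qed
    then show ?thesis using bounded_cball bounded_subset by blast
  qed
  have "interior K = Q"
  proof (rule antisym)
    show "Q \<subseteq> interior K" by (rule interior_maximal) (use \<open>open Q\<close> in \<open>auto simp: Q_def K_def\<close>)
    show "interior K \<subseteq> Q"
    proof
      fix p assume p: "p \<in> interior K"
      then obtain e where e: "e > 0" "cball p e \<subseteq> K" unfolding mem_interior_cball by auto
      \<comment> \<open>Shifting an interior point up and down along the normal makes both height
        inequalities strict. The abscissas \<open>a\<close> and \<open>b\<close> are then excluded,
        because \<open>f\<close> equals \<open>h\<close> there.\<close>
      have "p + e *\<^sub>R e2 \<in> K" "p - e *\<^sub>R e2 \<in> K" "p \<in> K"
        using e by (auto simp: subset_iff dist_norm norm2)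
      moreover have "x (p + e *\<^sub>R e2) = x p" "x (p - e *\<^sub>R e2) = x p"
          "y (p + e *\<^sub>R e2) = y p + e" "y (p - e *\<^sub>R e2) = y p - e"
        by (auto simp: x_def y_def inner_add_left inner_diff_left)
      ultimately have *: "a \<le> x p" "x p \<le> b" "f (x p) < y p" "y p < h"
        using e by (auto simp: K_def)
      then have "x p \<noteq> a" "x p \<noteq> b" using ends by auto
      with * show "p \<in> Q" by (auto simp: Q_def)
    qed
  qed
  have "frontier K = pt ` {a..b} \<union> closed_segment (pt a) (pt b)"
  proof -
    have pt_iff: "p = pt t \<longleftrightarrow> x p = t \<and> y p = f t" for p t
    proof
      assume "x p = t \<and> y p = f t"
      then show "p = pt t" using expand[of "p - P"] unfolding x_def y_def pt_def by (simp add: algebra_simps)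
    qed (auto simp: x_def y_def)
    have seg: "closed_segment (pt a) (pt b) = {p. a \<le> x p \<and> x p \<le> b \<and> y p = h}"
    proof (intro set_eqI iffI)
      fix p assume "p \<in> closed_segment (pt a) (pt b)"
      then obtain u where u: "0 \<le> u" "u \<le> 1" "p = (1 - u) *\<^sub>R pt a + u *\<^sub>R pt b"
        by (auto simp: in_segment)
      then have "p - P = ((1 - u) * a + u * b) *\<^sub>R e1 + h *\<^sub>R e2"
        unfolding pt_def by (simp add: ends algebra_simps)
      then have "x p = (1 - u) * a + u * b" "y p = h" by (auto simp: x_def y_def inner_add_left)
      moreover have "(1 - u) * a + u * b \<in> {a..b}"
        using convexD[of "{a..b}" a b "1 - u" u] u ends by auto
      ultimately show "p \<in> {p. a \<le> x p \<and> x p \<le> b \<and> y p = h}" by auto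
    next
      fix p assume p: "p \<in> {p. a \<le> x p \<and> x p \<le> b \<and> y p = h}"
      define u where "u = (x p - a) / (b - a)"
      have "u * (b - a) = x p - a" using ends by (simp add: u_def)
      then have "(1 - u) * a + u * b = x p" by (simp add: algebra_simps)
      moreover have "0 \<le> u" "u \<le> 1" using p ends by (auto simp: u_def)
      ultimately have u: "0 \<le> u" "u \<le> 1" "(1 - u) * a + u * b = x p" by auto
      have "p = P + (x p *\<^sub>R e1 + h *\<^sub>R e2)"
        using expand[of "p - P"] p unfolding x_def y_def by (simp add: algebra_simps)
      also have "\<dots> = (1 - u) *\<^sub>R pt a + u *\<^sub>R pt b"
        unfolding pt_def ends u(3)[symmetric] by (simp add: algebra_simps)
      finally show "p \<in> closed_segment (pt a) (pt b)" using u by (auto simp: in_segment)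
    qed
    have "frontier K = K - Q"
      using \<open>closed K\<close> \<open>interior K = Q\<close> by (simp add: frontier_def)
    also have "\<dots> = {p. a \<le> x p \<and> x p \<le> b \<and> y p = f (x p)} \<union> {p. a \<le> x p \<and> x p \<le> b \<and> y p = h}"
    proof (intro set_eqI iffI)
      fix p assume p: "p \<in> K - Q"
      have "x p = a \<Longrightarrow> f (x p) = h" "x p = b \<Longrightarrow> f (x p) = h" using ends by auto
      with p show "p \<in> {p. a \<le> x p \<and> x p \<le> b \<and> y p = f (x p)} \<union> {p. a \<le> x p \<and> x p \<le> b \<and> y p = h}"
        unfolding K_def Q_def by fastforce
    next
      fix p assume p: "p \<in> {p. a \<le> x p \<and> x p \<le> b \<and> y p = f (x p)} \<union> {p. a \<le> x p \<and> x p \<le> b \<and> y p = h}"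
      then have "f (x p) \<le> h" using below_chord[of "x p"] ends by (cases "x p = a \<or> x p = b") auto
      with p show "p \<in> K - Q" by (auto simp: K_def Q_def)
    qed
    also have "{p. a \<le> x p \<and> x p \<le> b \<and> y p = f (x p)} = pt ` {a..b}"
      by (force simp: image_iff pt_iff x_def y_def)
    finally show ?thesis using seg by simp
  qed
  then have inside: "inside (pt ` {a..b} \<union> closed_segment (pt a) (pt b)) = Q"
    using inside_frontier_eq_interior[OF \<open>bounded K\<close> \<open>convex K\<close>] \<open>interior K = Q\<close> by simp
  show "inside (pt ` {a..b} \<union> closed_segment (pt a) (pt b)) =
     {p. a < (p - P) \<bullet> e1 \<and> (p - P) \<bullet> e1 < b \<and> f ((p - P) \<bullet> e1) < (p - P) \<bullet> e2 \<and> (p - P) \<bullet> e2 < h}"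
    unfolding inside by (simp add: Q_def x_def y_def)
  show "open (inside (pt ` {a..b} \<union> closed_segment (pt a) (pt b)))"
    unfolding inside by fact
  have "Q \<subseteq> K" by (auto simp: Q_def K_def)
  then show "bounded (inside (pt ` {a..b} \<union> closed_segment (pt a) (pt b)))"
    unfolding inside using \<open>bounded K\<close> bounded_subset by blast
qed

end

section \<open>Moments of the section and the centroid condition\<close>

definition W :: "real \<Rightarrow> real" where "W h = rt 0 h - lt 0 h"

text \<open>The weights 1 and y give the area and the first moment about the tangent.\<close>

definition M :: "(real \<Rightarrow> real) \<Rightarrow> real \<Rightarrow> real" where "M k h = integral {0..h} (\<lambda>y. k y * W y)"

lemma W_continuous: "continuous_on {0..min (f l) (f r)} W"
  unfolding W_def using rt_continuous_on[of 0] lt_continuous_on[of 0] bounds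
  by (intro continuous_intros) (auto intro: continuous_on_subset)

lemma W_0: "W 0 = 0"
  using rt_eqI[of 0 0 0] lt_eqI[of 0 0 0] bounds vertex by (simp add: W_def)

lemma W_pos: "\<lbrakk>0 < h; h < f l; h < f r\<rbrakk> \<Longrightarrow> W h > 0"
  using ends[of h] by (simp add: W_def)

lemma height_pos: "0 < f l" "0 < f r"
  using gap_pos[of l 0] gap_pos[of r 0] bounds by auto

lemma M_0: "M k 0 = 0"
  by (simp add: M_def)

lemma M_deriv:
  assumes "continuous_on UNIV k" "0 < h" "h < f l" "h < f r"
  shows "(M k has_real_derivative k h * W h) (at h)"
proof -
  let ?m = "min (f l) (f r)"
  have "continuous_on {0..?m} (\<lambda>y. k y * W y)"
    using assms by (intro continuous_intros W_continuous) (auto intro: continuous_on_subset)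
  from integral_has_real_derivative[OF this, of h]
  have "((M k) has_real_derivative k h * W h) (at h within {0..?m})"
    unfolding M_def using assms by auto
  moreover have "at h within {0..?m} = at h" using assms by (intro at_within_interior) auto
  ultimately show ?thesis by simp
qed

lemma M_continuous:
  assumes "continuous_on UNIV k" "0 < h" "h < f l" "h < f r"
  shows "continuous_on {0..h} (M k)"
proof -
  have "continuous_on {0..h} (\<lambda>y. k y * W y)"
    using assms by (intro continuous_intros continuous_on_subset[OF W_continuous]) (auto intro: continuous_on_subset)
  then show ?thesis unfolding M_def
    by (intro indefinite_integral_continuous_1 integrable_continuous_real)
qed

lemma M_pos:
  assumes "continuous_on UNIV k" "0 < h" "h < f l" "h < f r" and "\<And>y. 0 < y \<Longrightarrow> k y > 0"
  shows "M k h > 0"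
proof -
  have "M k 0 < M k h"
  proof (rule DERIV_pos_imp_increasing_open[OF \<open>0 < h\<close>])
    show "\<exists>d. DERIV (M k) y :> d \<and> 0 < d" if "0 < y" "y < h" for y
      using M_deriv[of k y] W_pos[of y] assms that by (intro exI[of _ "k y * W y"]) auto
  qed (use assms in \<open>auto intro: M_continuous\<close>)
  then show ?thesis by (simp add: M_0)
qed

lemma centroid_height:
  assumes h: "0 < h" "h < f l" "h < f r"
  shows "(centroid (inside (pt ` {lt 0 h..rt 0 h} \<union> closed_segment (pt (lt 0 h)) (pt (rt 0 h)))) - P) \<bullet> e2
    = M (\<lambda>y. y) h / M (\<lambda>y. 1) h"
proof -
  define R where "R = inside (pt ` {lt 0 h..rt 0 h} \<union> closed_segment (pt (lt 0 h)) (pt (rt 0 h)))"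
  note R = section_eq[OF h, folded R_def]
  interpret sw: orthonormal_frame e2 e1 by (rule swap)
  \<comment> \<open>The section is described by vertical inequalities; monotonicity of
    \<open>f\<close> on each side of 0 turns them into horizontal slices, the slice at height y
    being the open chord from \<open>lt 0 y\<close> to \<open>rt 0 y\<close>.\<close>
  have slices: "P + (y *\<^sub>R e2 + x *\<^sub>R e1) \<in> R \<longleftrightarrow> 0 < y \<and> y < h \<and> lt 0 y < x \<and> x < rt 0 y" for x y
  proof -
    have "P + (y *\<^sub>R e2 + x *\<^sub>R e1) \<in> R \<longleftrightarrow> lt 0 h < x \<and> x < rt 0 h \<and> f x < y \<and> y < h"
      unfolding R by (simp add: inner_add_left)
    also have "\<dots> \<longleftrightarrow> 0 < y \<and> y < h \<and> lt 0 y < x \<and> x < rt 0 y"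
    proof
      assume *: "lt 0 h < x \<and> x < rt 0 h \<and> f x < y \<and> y < h"
      then have "0 \<le> f x" using gap_nonneg[of x 0] ends[OF h] bounds by auto
      with * have y: "0 < y" "y < f l" "y < f r" using h by auto
      note e = ends[OF y]
      have "x < rt 0 y"
      proof (rule ccontr)
        assume "\<not> x < rt 0 y"
        then show False using gap_less_right[of 0 "rt 0 y" x] e * ends[OF h] by (cases "x = rt 0 y") auto
      qed
      moreover have "lt 0 y < x"
      proof (rule ccontr)
        assume "\<not> lt 0 y < x"
        then show False using gap_less_left[of x "lt 0 y" 0] e * ends[OF h] by (cases "x = lt 0 y") auto
      qed
      ultimately show "0 < y \<and> y < h \<and> lt 0 y < x \<and> x < rt 0 y" using * y by auto
    next
      assume *: "0 < y \<and> y < h \<and> lt 0 y < x \<and> x < rt 0 y"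
      then have y: "0 < y" "y < f l" "y < f r" using h by auto
      note e = ends[OF y] and e' = ends[OF h]
      have "rt 0 y < rt 0 h"
      proof (rule ccontr)
        assume "\<not> ?thesis"
        then show False using gap_less_right[of 0 "rt 0 h" "rt 0 y"] e e' * by (cases "rt 0 y = rt 0 h") auto
      qed
      moreover have "lt 0 h < lt 0 y"
      proof (rule ccontr)
        assume "\<not> ?thesis"
        then show False using gap_less_left[of "lt 0 y" "lt 0 h" 0] e e' * by (cases "lt 0 y = lt 0 h") auto
      qed
      ultimately show "lt 0 h < x \<and> x < rt 0 h \<and> f x < y \<and> y < h"
        using * below_chord[OF y, of x] by auto
    qed
    finally show ?thesis .
  qed
  have LM: "(LINT p:R|lebesgue. k ((p - P) \<bullet> e2)) = M k h" if k: "continuous_on UNIV k" for k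
  proof -
    have "(LINT p:R|lebesgue. k ((p - P) \<bullet> e2)) = integral {0..h} (\<lambda>y. k y * (rt 0 y - lt 0 y))"
    proof (rule sw.integral_slices[OF R(2,3) h(1) slices _ _ k])
      show "lt 0 y \<le> rt 0 y" if "0 < y" "y < h" for y using ends[of y] that h by auto
      show "continuous_on {0..h} (\<lambda>y. rt 0 y - lt 0 y)"
        using continuous_on_subset[OF W_continuous, of "{0..h}"] h by (auto simp: W_def)
    qed
    then show ?thesis by (simp add: M_def W_def)
  qed
  have "measure lebesgue R = (LINT p:R|lebesgue. 1)"
    unfolding set_lebesgue_integral_def by (simp add: R(2))
  also have "\<dots> = M (\<lambda>y. 1) h" using LM[of "\<lambda>y. 1"] by simp
  finally have "measure lebesgue R \<noteq> 0" using M_pos[of "\<lambda>y. 1" h] h by simp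
  from sw.centroid_component[OF R(2,3) this, of P] LM[of "\<lambda>y. 1"] LM[of "\<lambda>y. y"] show ?thesis
    unfolding R_def by (simp add: continuous_on_id)
qed

lemma sqrt_width_iff: "(\<exists>c. \<exists>H>0. sqrt_width 0 c H) \<longleftrightarrow> (\<exists>c. \<forall>\<^sub>F h in at_right 0. W h = c * sqrt h)"
proof
  assume "\<exists>c. \<exists>H>0. sqrt_width 0 c H"
  then obtain c H where "H > 0" "sqrt_width 0 c H" by auto
  moreover from this have "\<forall>\<^sub>F h in at_right 0. h \<in> {0<..<Min {H, f l, f r}}"
    using height_pos by (intro eventually_at_right_real) auto
  ultimately have "\<forall>\<^sub>F h in at_right 0. W h = c * sqrt h"
    by (elim eventually_mono) (use bounds in \<open>auto simp: W_def intro: sqrt_widthD\<close>)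
  then show "\<exists>c. \<forall>\<^sub>F h in at_right 0. W h = c * sqrt h" ..
next
  assume "\<exists>c. \<forall>\<^sub>F h in at_right 0. W h = c * sqrt h"
  then obtain c H where H: "H > 0" "\<And>h. 0 < h \<Longrightarrow> h < H \<Longrightarrow> W h = c * sqrt h"
    unfolding eventually_at_right_field by auto
  have "sqrt_width 0 c H"
    unfolding sqrt_width_def
  proof (intro allI impI)
    fix a b assume *: "l \<le> a \<and> a < 0 \<and> 0 < b \<and> b \<le> r \<and> gap a 0 = gap b 0 \<and> gap b 0 < H"
    then have "lt 0 (f b) = a" "rt 0 (f b) = b" "f b > 0"
      using lt_eqI[of 0 a "f b"] rt_eqI[of 0 b "f b"] gap_pos[of b 0] bounds by auto
    then show "b - a = c * sqrt (gap b 0)" using H(2)[of "f b"] * by (simp add: W_def)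
  qed
  then show "\<exists>c. \<exists>H>0. sqrt_width 0 c H" using H by auto
qed

text \<open>For W = c sqrt y the two moments are (2/3) c h^(3/2) and (2/5) c h^(5/2). Conversely,
  differentiating M1 = (3/5) h M0 yields the Euler equation h M0' = (3/2) M0, so M0 is a multiple of
  h^(3/2) and W = M0' one of sqrt h.\<close>

lemma centroid_iff_sqrt_width:
  "(\<forall>\<^sub>F h in at_right 0. M (\<lambda>y. y) h / M (\<lambda>y. 1) h = 3 / 5 * h) \<longleftrightarrow> (\<exists>c. \<exists>H>0. sqrt_width 0 c H)"
  unfolding sqrt_width_iff
proof
  assume "\<exists>c. \<forall>\<^sub>F h in at_right 0. W h = c * sqrt h"
  then obtain c H0 where H0: "H0 > 0" "\<And>h. 0 < h \<Longrightarrow> h < H0 \<Longrightarrow> W h = c * sqrt h"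
    unfolding eventually_at_right_field by auto
  define H where "H = Min {H0, f l, f r}"
  have H: "H > 0" "H \<le> H0" "H \<le> f l" "H \<le> f r" using H0 height_pos by (auto simp: H_def)
  have "M (\<lambda>y. y) h / M (\<lambda>y. 1) h = 3 / 5 * h" if h: "0 < h" "h < H" for h
  proof -
    have W: "W y = c * sqrt y" if "y \<in> {0..h}" for y
      using that H0(2)[of y] W_0 h H by (cases "y = 0") auto
    have "c \<noteq> 0" using W[of h] W_pos[of h] h H by auto
    have "M (\<lambda>y. 1) h = integral {0..h} (\<lambda>y. c * sqrt y)"
      unfolding M_def using W by (intro integral_cong) auto
    also have "\<dots> = c * (2/3) * (h * sqrt h) - c * (2/3) * (0 * sqrt 0)"
    proof (intro integral_unique fundamental_theorem_of_calculus_interior)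
      fix y assume y: "y \<in> {0<..<h}"
      have "((\<lambda>y. c * (2/3) * (y * sqrt y)) has_real_derivative c * (2/3) * (sqrt y + y * (inverse (sqrt y) / 2))) (at y)"
        using y by (auto intro!: derivative_eq_intros)
      moreover have "y * inverse (sqrt y) = sqrt y" using y by (simp add: field_simps)
      then have "y * (inverse (sqrt y) / 2) = sqrt y / 2" by simp
      then have "c * (2/3) * (sqrt y + y * (inverse (sqrt y) / 2)) = c * sqrt y"
        by (simp only:) (simp add: algebra_simps)
      ultimately show "((\<lambda>y. c * (2/3) * (y * sqrt y)) has_vector_derivative c * sqrt y) (at y)"
        by (simp only: has_real_derivative_iff_has_vector_derivative)
    qed (use h in \<open>auto intro!: continuous_intros\<close>)
    finally have M0: "M (\<lambda>y. 1) h = c * (2/3) * (h * sqrt h)" by simp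
    have "M (\<lambda>y. y) h = integral {0..h} (\<lambda>y. y * (c * sqrt y))"
      unfolding M_def using W by (intro integral_cong) auto
    also have "\<dots> = c * (2/5) * (h\<^sup>2 * sqrt h) - c * (2/5) * (0\<^sup>2 * sqrt 0)"
    proof (intro integral_unique fundamental_theorem_of_calculus_interior)
      fix y assume y: "y \<in> {0<..<h}"
      have "((\<lambda>y. c * (2/5) * (y\<^sup>2 * sqrt y)) has_real_derivative c * (2/5) * (2 * y * sqrt y + y\<^sup>2 * (inverse (sqrt y) / 2))) (at y)"
        using y by (auto intro!: derivative_eq_intros)
      moreover have "y\<^sup>2 * inverse (sqrt y) = y * sqrt y" using y by (simp add: field_simps power2_eq_square)
      then have "y\<^sup>2 * (inverse (sqrt y) / 2) = y * sqrt y / 2" by simp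
      then have "c * (2/5) * (2 * y * sqrt y + y\<^sup>2 * (inverse (sqrt y) / 2)) = y * (c * sqrt y)"
        by (simp only:) (simp add: algebra_simps)
      ultimately show "((\<lambda>y. c * (2/5) * (y\<^sup>2 * sqrt y)) has_vector_derivative y * (c * sqrt y)) (at y)"
        by (simp only: has_real_derivative_iff_has_vector_derivative)
    qed (use h in \<open>auto intro!: continuous_intros\<close>)
    finally have M1: "M (\<lambda>y. y) h = c * (2/5) * (h\<^sup>2 * sqrt h)" by simp
    show ?thesis unfolding M0 M1 using \<open>c \<noteq> 0\<close> h by (simp add: power2_eq_square field_simps)
  qed
  then show "\<forall>\<^sub>F h in at_right 0. M (\<lambda>y. y) h / M (\<lambda>y. 1) h = 3 / 5 * h"
    unfolding eventually_at_right_field using H by blast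
next
  assume "\<forall>\<^sub>F h in at_right 0. M (\<lambda>y. y) h / M (\<lambda>y. 1) h = 3 / 5 * h"
  then obtain H0 where H0: "H0 > 0" "\<And>h. 0 < h \<Longrightarrow> h < H0 \<Longrightarrow> M (\<lambda>y. y) h / M (\<lambda>y. 1) h = 3 / 5 * h"
    unfolding eventually_at_right_field by auto
  define H where "H = Min {H0, f l, f r}"
  have H: "H > 0" "H \<le> H0" "H \<le> f l" "H \<le> f r" using H0 height_pos by (auto simp: H_def)
  let ?M0 = "M (\<lambda>y. 1)" and ?M1 = "M (\<lambda>y. y)"
  have M0': "(?M0 has_real_derivative W h) (at h)" and M1': "(?M1 has_real_derivative h * W h) (at h)"
    if "0 < h" "h < H" for h
    using M_deriv[of "\<lambda>y. 1" h] M_deriv[of "\<lambda>y. y" h] that H by (auto simp: continuous_on_id)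
  have M1: "?M1 h = 3 / 5 * (h * ?M0 h)" if "0 < h" "h < H" for h
    using H0(2)[of h] M_pos[of "\<lambda>y. 1" h] that H by (simp add: field_simps)
  \<comment> \<open>The derivative of M1 is h W, that of (3/5) h M0 is (3/5) (M0 + h W).\<close>
  have WM: "2 * h * W h = 3 * ?M0 h" if h: "0 < h" "h < H" for h
  proof -
    have "((\<lambda>h. 3 / 5 * (h * ?M0 h)) has_real_derivative 3 / 5 * (?M0 h + h * W h)) (at h)"
      using M0'[OF h] by (auto intro!: derivative_eq_intros)
    moreover have "\<forall>\<^sub>F h in nhds h. h \<in> {0<..<H}" by (rule eventually_nhds_in_open) (use h in auto)
    then have "\<forall>\<^sub>F h in nhds h. ?M1 h = 3 / 5 * (h * ?M0 h)"
      by eventually_elim (use M1 in auto)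
    ultimately have "(?M1 has_real_derivative 3 / 5 * (?M0 h + h * W h)) (at h)"
      by (subst DERIV_cong_ev[OF refl _ refl])
    from DERIV_unique[OF this M1'[OF h]] show ?thesis by simp
  qed
  define G where "G h = ?M0 h / (h * sqrt h)" for h
  have G': "(G has_real_derivative 0) (at h)" if h: "0 < h" "h < H" for h
  proof -
    have "(G has_real_derivative (W h * (h * sqrt h) - ?M0 h * (sqrt h + h * (inverse (sqrt h) / 2))) / ((h * sqrt h) * (h * sqrt h))) (at h)"
      unfolding G_def using h by (auto intro!: derivative_eq_intros M0')
    moreover have "h * inverse (sqrt h) = sqrt h" using h by (simp add: field_simps)
    then have "h * (inverse (sqrt h) / 2) = sqrt h / 2" by simp
    then have "W h * (h * sqrt h) - ?M0 h * (sqrt h + h * (inverse (sqrt h) / 2)) = (2 * h * W h - 3 * ?M0 h) * sqrt h / 2"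
      by (simp only:) (simp add: algebra_simps)
    ultimately show ?thesis by (simp add: WM[OF h])
  qed
  \<comment> \<open>The factor 3/2 comes from W = 3 M0 / (2 h) with M0 = G h sqrt h, where
    \<open>G\<close> is constant.\<close>
  define c where "c = 3 / 2 * G (H/2)"
  have "W h = c * sqrt h" if h: "0 < h" "h < H" for h
  proof -
    have "\<exists>k. \<forall>x\<in>{0<..<H}. G x = k"
      by (rule has_field_derivative_zero_constant) (auto intro: has_field_derivative_at_within G')
    then have "G h = G (H/2)" using h H by auto
    then have *: "?M0 h = 2 / 3 * c * (h * sqrt h)" using h by (simp add: c_def G_def field_simps)
    have "2 * h * W h = 2 * h * (c * sqrt h)" unfolding WM[OF h] * by simp
    then show ?thesis using h by simp
  qed
  then show "\<exists>c. \<forall>\<^sub>F h in at_right 0. W h = c * sqrt h"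
    unfolding eventually_at_right_field using H by blast
qed

end

section \<open>Parabolas\<close>

definition independent2 :: "real^2 \<Rightarrow> real^2 \<Rightarrow> bool" where
  "independent2 v w \<longleftrightarrow> v $ 1 * w $ 2 \<noteq> v $ 2 * w $ 1"

text \<open>An affine normal form: the parabola passes through \<open>P\<close> with normal
  \<open>w\<close>, and its axis is orthogonal to \<open>v\<close>. Since \<open>v\<close> and
  \<open>w\<close> may be oblique, the form adapts to coordinates at any point of the parabola and
  not only at the vertex.\<close>

definition quad_parabola :: "real^2 \<Rightarrow> real^2 \<Rightarrow> real^2 \<Rightarrow> (real^2) set" where
  "quad_parabola P v w = {p. ((p - P) \<bullet> v)\<^sup>2 = (p - P) \<bullet> w}"

lemma independent2_zero:
  assumes "independent2 v w" "z \<bullet> v = 0" "z \<bullet> w = 0" shows "z = 0"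
proof -
  let ?D = "v $ 1 * w $ 2 - v $ 2 * w $ 1"
  have "z $ 1 * ?D = (z \<bullet> v) * w $ 2 - (z \<bullet> w) * v $ 2" "z $ 2 * ?D = (z \<bullet> w) * v $ 1 - (z \<bullet> v) * w $ 1"
    unfolding inner_vec2 by (simp_all add: algebra_simps)
  then have "z $ 1 = 0" "z $ 2 = 0" using assms by (auto simp: independent2_def)
  then show ?thesis by (simp add: vec_eq_iff forall_2)
qed

lemma (in orthonormal_frame) independent2I:
  assumes "(v \<bullet> e1) * (w \<bullet> e2) \<noteq> (v \<bullet> e2) * (w \<bullet> e1)" shows "independent2 v w"
proof -
  have "(v \<bullet> e1) * (w \<bullet> e2) - (v \<bullet> e2) * (w \<bullet> e1) =
      (v $ 1 * w $ 2 - v $ 2 * w $ 1) * (e1 $ 1 * e2 $ 2 - e1 $ 2 * e2 $ 1)"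
    unfolding inner_vec2 by (simp add: algebra_simps)
  then show ?thesis using assms by (auto simp: independent2_def)
qed

lemma orthonormal_frame_exists:
  assumes "norm (n::real^2) = 1" obtains e where "orthonormal_frame e n"
proof
  have "n \<bullet> n = 1" using assms by (simp add: norm_eq_1)
  then show "orthonormal_frame (vector [- n $ 2, n $ 1]) n"
    using assms by unfold_locales (auto simp: norm_eq_1 inner_vec2 algebra_simps)
qed

text \<open>Squaring the equality of distances turns it into x^2 = 2 d y. Here \<open>P\<close> is
  the vertex and \<open>d\<close> the signed distance of the focus from the directrix; its sign
  tells on which side the parabola opens.\<close>

lemma (in orthonormal_frame) focus_directrix:
  assumes "d \<noteq> 0"
  shows "quad_parabola P e1 ((2 * d) *\<^sub>R e2) =
    {p. dist p (P + (d/2) *\<^sub>R e2) = infdist p {q. (q - (P - (d/2) *\<^sub>R e2)) \<bullet> e2 = 0}}"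
proof (intro Collect_cong[of "\<lambda>p. ((p - P) \<bullet> e1)\<^sup>2 = (p - P) \<bullet> ((2 * d) *\<^sub>R e2)", folded quad_parabola_def])
  fix p
  define x where "x = (p - P) \<bullet> e1"
  define y where "y = (p - P) \<bullet> e2"
  have *: "x\<^sup>2 = 2 * d * y \<longleftrightarrow> x\<^sup>2 + (y - d/2)\<^sup>2 = (y + d/2)\<^sup>2" for x y
    by (simp add: power2_eq_square algebra_simps)
  have "(dist p (P + (d/2) *\<^sub>R e2))\<^sup>2 = x\<^sup>2 + (y - d/2)\<^sup>2"
    unfolding dist_norm norm_sq x_def y_def by (simp add: inner_diff_left inner_add_left diff_diff_eq)
  moreover have "(p - (P - (d/2) *\<^sub>R e2)) \<bullet> e2 = y + d/2"
    by (simp add: y_def inner_diff_left)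
  then have "(infdist p {q. (q - (P - (d/2) *\<^sub>R e2)) \<bullet> e2 = 0})\<^sup>2 = (y + d/2)\<^sup>2"
    unfolding infdist_hyperplane by simp
  moreover have "dist p (P + (d/2) *\<^sub>R e2) = infdist p {q. (q - (P - (d/2) *\<^sub>R e2)) \<bullet> e2 = 0} \<longleftrightarrow>
      (dist p (P + (d/2) *\<^sub>R e2))\<^sup>2 = (infdist p {q. (q - (P - (d/2) *\<^sub>R e2)) \<bullet> e2 = 0})\<^sup>2"
    by (simp add: infdist_nonneg)
  ultimately show "((p - P) \<bullet> e1)\<^sup>2 = (p - P) \<bullet> ((2 * d) *\<^sub>R e2) \<longleftrightarrow>
      dist p (P + (d/2) *\<^sub>R e2) = infdist p {q. (q - (P - (d/2) *\<^sub>R e2)) \<bullet> e2 = 0}"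
    using *[of x y] by (simp only: inner_scaleR_right x_def y_def)
qed

lemma parabola_imp_quad:
  assumes "parabola Q" obtains P v w where "independent2 v w" "Q = quad_parabola P v w"
proof -
  obtain F L where L: "affine L" "aff_dim L = 1" "F \<notin> L" "Q = {p. dist p F = infdist p L}"
    using assms unfolding parabola_def by auto
  obtain a b where ab: "a \<noteq> 0" "L = {x. a \<bullet> x = b}"
    using aff_dim_eq_hyperplane[of L] L hull_same[of affine L] by auto
  define n where "n = a /\<^sub>R norm a"
  have n: "norm n = 1" using ab by (simp add: n_def)
  obtain e where "orthonormal_frame e n" using orthonormal_frame_exists[OF n] .
  then interpret orthonormal_frame e n .
  have Ln: "x \<in> L \<longleftrightarrow> x \<bullet> n = b / norm a" for x
    using ab by (simp add: n_def inner_commute divide_inverse mult.commute)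
  define d where "d = F \<bullet> n - b / norm a"
  have "d \<noteq> 0" using L Ln by (simp add: d_def)
  \<comment> \<open>The vertex lies halfway between the focus and the directrix.\<close>
  define P where "P = F - (d/2) *\<^sub>R n"
  have "F = P + (d/2) *\<^sub>R n" by (simp add: P_def)
  moreover have "P - (d/2) *\<^sub>R n = F - d *\<^sub>R n"
    by (simp add: P_def diff_diff_eq flip: scaleR_left_distrib)
  then have "L = {q. (q - (P - (d/2) *\<^sub>R n)) \<bullet> n = 0}"
    by (auto simp: Ln d_def inner_diff_left)
  ultimately have "Q = quad_parabola P e ((2 * d) *\<^sub>R n)"
    unfolding L(4) by (subst focus_directrix[OF \<open>d \<noteq> 0\<close>]) simp
  moreover have "independent2 e ((2 * d) *\<^sub>R n)" by (rule independent2I) (use \<open>d \<noteq> 0\<close> in simp)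
  ultimately show ?thesis using that by blast
qed

text \<open>In the frame along \<open>v\<close> the equation reads x^2 = 2 s x + 2 d y; completing
  the square moves the origin to the vertex. Independence guarantees that \<open>w\<close> has a
  component orthogonal to \<open>v\<close>, that is, d is nonzero.\<close>

lemma quad_imp_parabola:
  assumes "independent2 v w" shows "parabola (quad_parabola P v w)"
proof -
  have "v \<noteq> 0" using assms by (auto simp: independent2_def)
  define e where "e = v /\<^sub>R norm v"
  have e: "norm e = 1" "v = norm v *\<^sub>R e" using \<open>v \<noteq> 0\<close> by (auto simp: e_def)
  obtain n where "orthonormal_frame n e" using orthonormal_frame_exists[OF e(1)] .
  then interpret orthonormal_frame e n by (rule orthonormal_frame.swap)
  define N where "N = (norm v)\<^sup>2"
  define w1 where "w1 = w \<bullet> e"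
  define w2 where "w2 = w \<bullet> n"
  have w: "w = w1 *\<^sub>R e + w2 *\<^sub>R n" unfolding w1_def w2_def by (rule expand)
  have "N > 0" using \<open>v \<noteq> 0\<close> by (simp add: N_def)
  have "w2 \<noteq> 0"
  proof
    assume "w2 = 0"
    then have "n \<bullet> v = 0" "n \<bullet> w = 0" by (subst e(2), simp, subst w, simp add: inner_add_right)
    then have "n = 0" using independent2_zero[OF assms] by blast
    then show False using norm2 by simp
  qed
  define d where "d = w2 / (2 * N)"
  define s where "s = w1 / (2 * N)"
  have "d \<noteq> 0" using \<open>w2 \<noteq> 0\<close> \<open>N > 0\<close> by (simp add: d_def)
  define P' where "P' = P + (s *\<^sub>R e - (s\<^sup>2 / (2 * d)) *\<^sub>R n)"
  have "quad_parabola P v w = quad_parabola P' e ((2 * d) *\<^sub>R n)"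
    unfolding quad_parabola_def
  proof (rule Collect_cong)
    fix p
    define x where "x = (p - P) \<bullet> e"
    define y where "y = (p - P) \<bullet> n"
    have "((p - P) \<bullet> v)\<^sup>2 = N * x\<^sup>2" by (subst e(2)) (simp add: x_def N_def power_mult_distrib)
    moreover have "(p - P) \<bullet> w = N * (2 * s * x + 2 * d * y)"
      using \<open>N > 0\<close> by (subst w) (simp add: inner_add_right d_def s_def field_simps flip: x_def y_def)
    moreover have "(p - P') \<bullet> e = x - s" "(p - P') \<bullet> n = y + s\<^sup>2 / (2 * d)"
      by (simp_all add: P'_def x_def y_def inner_diff_left inner_add_left)
    moreover have "N * x\<^sup>2 = N * (2 * s * x + 2 * d * y) \<longleftrightarrow> x\<^sup>2 = 2 * s * x + 2 * d * y"
      using \<open>N > 0\<close> by simp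
    moreover have "2 * d * (y + s\<^sup>2 / (2 * d)) = 2 * d * y + s\<^sup>2" using \<open>d \<noteq> 0\<close> by (simp add: field_simps)
    ultimately show "((p - P) \<bullet> v)\<^sup>2 = (p - P) \<bullet> w \<longleftrightarrow> ((p - P') \<bullet> e)\<^sup>2 = (p - P') \<bullet> ((2 * d) *\<^sub>R n)"
      by (simp add: power2_diff) (auto simp: algebra_simps)
  qed
  also have "parabola \<dots>"
    unfolding parabola_def
  proof (intro exI conjI)
    let ?L = "{q. (q - (P' - (d/2) *\<^sub>R n)) \<bullet> n = 0}"
    have L: "?L = {q. n \<bullet> q = n \<bullet> (P' - (d/2) *\<^sub>R n)}"
      by (auto simp: inner_diff_left inner_diff_right inner_commute)
    have "n \<noteq> 0" using norm2 by auto
    show "affine ?L" unfolding L by (rule affine_hyperplane)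
    show "aff_dim ?L = 1" unfolding L using \<open>n \<noteq> 0\<close> by simp
    show "P' + (d/2) *\<^sub>R n \<notin> ?L" using \<open>d \<noteq> 0\<close> by (simp add: inner_diff_left inner_add_left)
    show "quad_parabola P' e ((2 * d) *\<^sub>R n) = {p. dist p (P' + (d/2) *\<^sub>R n) = infdist p ?L}"
      by (rule focus_directrix[OF \<open>d \<noteq> 0\<close>])
  qed
  finally show ?thesis .
qed

text \<open>Taking a point of the parabola as origin removes the constant term, and taking its
  tangent as first axis removes the term linear in x. The shape that remains is the one handled by
  the extension lemmas. If \<open>T\<close> were orthogonal to \<open>v\<close>, tangency would make
  it orthogonal to \<open>w\<close> as well, hence zero; so \<open>al\<close> is nonzero.\<close>

lemma quad_parabola_tangent_form:
  assumes ind: "independent2 v w" and P0: "P0 \<in> quad_parabola P v w"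
    and T: "T \<noteq> 0" "2 * ((P0 - P) \<bullet> v) * (T \<bullet> v) = T \<bullet> w"
  obtains al be ga where "al \<noteq> 0"
    "\<And>x h. P0 + (x *\<^sub>R T + h *\<^sub>R N) \<in> quad_parabola P v w \<longleftrightarrow> (al * x + be * h)\<^sup>2 = ga * h"
proof
  define c where "c = (P0 - P) \<bullet> v"
  show "T \<bullet> v \<noteq> 0"
  proof
    assume "T \<bullet> v = 0"
    with T(2) have "T \<bullet> w = 0" by simp
    with \<open>T \<bullet> v = 0\<close> T(1) independent2_zero[OF ind] show False by blast
  qed
  fix x h
  have *: "(P0 + (x *\<^sub>R T + h *\<^sub>R N) - P) \<bullet> u = (P0 - P) \<bullet> u + (x * (T \<bullet> u) + h * (N \<bullet> u))" for u
    by (simp add: inner_diff_left inner_add_left)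
  have "c\<^sup>2 = (P0 - P) \<bullet> w" using P0 by (simp add: quad_parabola_def c_def)
  then show "P0 + (x *\<^sub>R T + h *\<^sub>R N) \<in> quad_parabola P v w \<longleftrightarrow>
      ((T \<bullet> v) * x + (N \<bullet> v) * h)\<^sup>2 = (N \<bullet> w - 2 * c * (N \<bullet> v)) * h"
    unfolding quad_parabola_def mem_Collect_eq * using T(2)
    by (simp add: power2_sum power_mult_distrib flip: c_def) (auto simp: algebra_simps)
qed

section \<open>Strictly convex curves as graphs\<close>

text \<open>Convexity enters only as positivity of the normal part of the second derivative. For a
  regular parameter this is positive curvature, since a change of parameter adds a tangential term
  and multiplies the normal part by a positive square.\<close>

locale strict_curve =
  fixes X X1 X2 N :: "real \<Rightarrow> real^2" and I :: "real set"
  assumes open_I: "open I" and interval_I: "is_interval I"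
    and deriv_X: "t \<in> I \<Longrightarrow> (X has_vector_derivative X1 t) (at t)"
    and deriv_X1: "t \<in> I \<Longrightarrow> (X1 has_vector_derivative X2 t) (at t)"
    and cont_X2: "continuous_on I X2"
    and regular: "t \<in> I \<Longrightarrow> X1 t \<noteq> 0"
    and unit_normal: "t \<in> I \<Longrightarrow> norm (N t) = 1"
    and normal: "t \<in> I \<Longrightarrow> N t \<bullet> X1 t = 0"
    and strict: "t \<in> I \<Longrightarrow> X2 t \<bullet> N t > 0"
begin

lemma Icc_subset: "\<lbrakk>a \<in> I; b \<in> I\<rbrakk> \<Longrightarrow> {a..b} \<subseteq> I"
  using mem_is_interval_1_I[OF interval_I, of a b] unfolding atLeastAtMost_def by blast

lemma inner_deriv: "t \<in> I \<Longrightarrow> ((\<lambda>t. (X t - P) \<bullet> e) has_real_derivative X1 t \<bullet> e) (at t)"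
  using has_derivative_inner_left[OF has_derivative_diff[OF deriv_X[unfolded has_vector_derivative_def] has_derivative_const], of t P e]
  unfolding has_field_derivative_def by (simp add: mult_commute_abs)

lemma inner_deriv1: "t \<in> I \<Longrightarrow> ((\<lambda>t. X1 t \<bullet> e) has_real_derivative X2 t \<bullet> e) (at t)"
  using has_derivative_inner_left[OF deriv_X1[unfolded has_vector_derivative_def], of t e]
  unfolding has_field_derivative_def by (simp add: mult_commute_abs)

lemma cont_X: "continuous_on I X" and cont_X1: "continuous_on I X1"
  using deriv_X deriv_X1
  by (auto intro!: continuous_at_imp_continuous_on intro: has_vector_derivative_continuous)

lemma tangent_frame: "t \<in> I \<Longrightarrow> orthonormal_frame (X1 t /\<^sub>R norm (X1 t)) (N t)"
  by unfold_locales (use regular unit_normal normal in \<open>auto simp: inner_commute\<close>)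

lemma vector_derivative_X: "t \<in> I \<Longrightarrow> vector_derivative X (at t) = X1 t"
  using deriv_X by (rule vector_derivative_at)

lemma line_eq_hyperplane:
  assumes "t \<in> I" shows "{P + c *\<^sub>R X1 t | c. True} = {p. (p - P) \<bullet> N t = 0}"
proof -
  have "{P + c *\<^sub>R X1 t | c. True} = {P + c *\<^sub>R (X1 t /\<^sub>R norm (X1 t)) | c. True}"
  proof (intro set_eqI iffI)
    fix p assume "p \<in> {P + c *\<^sub>R X1 t | c. True}"
    then obtain c where "p = P + c *\<^sub>R X1 t" by auto
    then have "p = P + (c * norm (X1 t)) *\<^sub>R (X1 t /\<^sub>R norm (X1 t))" using regular[OF assms] by simp
    then show "p \<in> {P + c *\<^sub>R (X1 t /\<^sub>R norm (X1 t)) | c. True}" by blast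
  qed auto
  then show ?thesis using orthonormal_frame.line_eq_hyperplane[OF tangent_frame[OF assms]] by simp
qed

lemma mem_cutting_line: "t \<in> I \<Longrightarrow> p \<in> cutting_line X N t h \<longleftrightarrow> (p - X t) \<bullet> N t = h"
  using line_eq_hyperplane[of t "X t + h *\<^sub>R N t"] unit_normal[of t]
  unfolding cutting_line_def vector_derivative_X
  by (auto simp: inner_diff_left inner_add_left norm_eq_1)

lemma infdist_tangent_line: "t \<in> I \<Longrightarrow> infdist p (tangent_line X t) = \<bar>(p - X t) \<bullet> N t\<bar>"
  using line_eq_hyperplane[of t "X t"] orthonormal_frame.infdist_hyperplane[OF tangent_frame]
  unfolding tangent_line_def vector_derivative_X by simp

end

text \<open>\<open>u\<close> inverts the tangential coordinate at \<open>s\<close>, so the chart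
  variable is an abscissa in the frame at \<open>s\<close>. The last condition identifies
  \<open>N\<close> along the whole chart with the upward unit normal of the graph, which makes
  chords at all nearby base points accessible in this one chart.\<close>

locale curve_chart =
  strict_curve X X1 X2 N I +
  framed_graph f f' f'' l r "X1 s /\<^sub>R norm (X1 s)" "N s" "X s"
  for X X1 X2 N I s f f' f'' l r +
  fixes u :: "real \<Rightarrow> real"
  assumes s: "s \<in> I" and u0: "u 0 = s" and u_cont: "continuous_on {l..r} u"
    and u_less: "\<lbrakk>l \<le> a; a < b; b \<le> r\<rbrakk> \<Longrightarrow> u a < u b"
    and u_mem: "t \<in> {l..r} \<Longrightarrow> u t \<in> I"
    and X_u: "t \<in> {l..r} \<Longrightarrow> X (u t) = pt t"
    and N_u: "t \<in> {l..r} \<Longrightarrow> N (u t) = (1 / sqrt (1 + (f' t)\<^sup>2)) *\<^sub>R (N s - f' t *\<^sub>R (X1 s /\<^sub>R norm (X1 s)))"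

lemma (in strict_curve) chart_exists:
  assumes s: "s \<in> I"
  shows "\<exists>f f' f'' l r u. curve_chart X X1 X2 N I s f f' f'' l r u"
proof -
  define e1 where "e1 = X1 s /\<^sub>R norm (X1 s)"
  define e2 where "e2 = N s"
  interpret orthonormal_frame e1 e2 unfolding e1_def e2_def by (rule tangent_frame[OF s])
  define x where "x t = (X t - X s) \<bullet> e1" for t
  define y where "y t = (X t - X s) \<bullet> e2" for t
  define x1 where "x1 t = X1 t \<bullet> e1" for t
  define y1 where "y1 t = X1 t \<bullet> e2" for t
  define x2 where "x2 t = X2 t \<bullet> e1" for t
  define y2 where "y2 t = X2 t \<bullet> e2" for t
  \<comment> \<open>The numerator of the curvature: the graph will have slope y1 / x1 and second
    derivative k / x1^3.\<close>
  define k where "k t = y2 t * x1 t - y1 t * x2 t" for t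
  have dx: "(x has_real_derivative x1 t) (at t)" and dy: "(y has_real_derivative y1 t) (at t)"
    and dx1: "(x1 has_real_derivative x2 t) (at t)" and dy1: "(y1 has_real_derivative y2 t) (at t)"
    if "t \<in> I" for t
    unfolding x_def y_def x1_def[abs_def] y1_def[abs_def] x2_def y2_def
    using that by (rule inner_deriv inner_deriv1)+
  have x1s: "x1 s > 0" using regular[OF s] by (simp add: x1_def e1_def power2_norm_eq_inner[symmetric] power2_eq_square)
  moreover have "y1 s = 0" using normal[OF s] by (simp add: y1_def e2_def inner_commute)
  ultimately have ks: "k s > 0" using strict[OF s] by (simp add: k_def y2_def e2_def)
  have "continuous_on I x1" "continuous_on I k"
    unfolding k_def[abs_def] x1_def[abs_def] y1_def[abs_def] x2_def[abs_def] y2_def[abs_def]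
    by (intro continuous_intros cont_X1 cont_X2)+
  then have "open (I \<inter> x1 -` {0<..})" "open (I \<inter> k -` {0<..})"
    using open_I by (auto intro!: continuous_open_preimage)
  then have "open ((I \<inter> x1 -` {0<..}) \<inter> (I \<inter> k -` {0<..}))" by (rule open_Int)
  moreover have "s \<in> (I \<inter> x1 -` {0<..}) \<inter> (I \<inter> k -` {0<..})" using s x1s ks by auto
  ultimately obtain e where e: "e > 0" "cball s e \<subseteq> (I \<inter> x1 -` {0<..}) \<inter> (I \<inter> k -` {0<..})"
    unfolding open_contains_cball by metis
  define p where "p = s - e"
  define q where "q = s + e"
  have pq: "p < s" "s < q" using e by (auto simp: p_def q_def)
  have "cball s e = {p..q}" by (auto simp: p_def q_def dist_real_def)
  then have pos: "t \<in> I" "x1 t > 0" "k t > 0" if "t \<in> {p..q}" for t using e that by auto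
  have x_less: "x a < x b" if "p \<le> a" "a < b" "b \<le> q" for a b
    by (rule DERIV_pos_imp_increasing[OF \<open>a < b\<close>, of x])
       (meson atLeastAtMost_iff dx order_trans pos(1,2) that(1,3))
  have x_cont: "continuous_on {p..q} x"
    by (intro continuous_at_imp_continuous_on) (use dx pos DERIV_isCont in blast)
  have "x s = 0" "y s = 0" by (simp_all add: x_def y_def)
  then have xpq: "x p < 0" "0 < x q" using x_less[of p s] x_less[of s q] pq by auto
  have inj: "inj_on x {p..q}"
    by (rule linorder_inj_onI) (use x_less in \<open>auto simp: less_imp_neq\<close>)
  define u where "u = the_inv_into {p..q} x"
  have ux: "u (x t) = t" if "t \<in> {p..q}" for t
    unfolding u_def using inj that by (rule the_inv_into_f_f)
  have img: "\<exists>t\<in>{p..q}. x t = z" if "z \<in> {x p..x q}" for z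
    using IVT'[of x p z q] x_cont that pq by auto
  have u: "u z \<in> {p..q}" "x (u z) = z" if "z \<in> {x p..x q}" for z
    using img[OF that] ux by auto
  have "continuous_on (x ` {p..q}) u"
    by (rule continuous_on_inv) (use x_cont ux in auto)
  then have u_cont: "continuous_on {x p..x q} u"
    by (rule continuous_on_subset) (use img in force)
  \<comment> \<open>Halving keeps \<open>l\<close> and \<open>r\<close> inside the range of the
    coordinate, so that the derivatives are two-sided at the ends as well.\<close>
  define l where "l = x p / 2"
  define r where "r = x q / 2"
  have lr: "x p < l" "l < 0" "0 < r" "r < x q" using xpq by (auto simp: l_def r_def)
  have sub: "t \<in> {x p<..<x q}" "t \<in> {x p..x q}" if "t \<in> {l..r}" for t using that lr by auto
  have du: "(u has_real_derivative inverse (x1 (u t))) (at t)" if t: "t \<in> {l..r}" for t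
  proof (rule DERIV_inverse_function[of x _ _ _ "x p" "x q"])
    show "DERIV x (u t) :> x1 (u t)" using u(1)[OF sub(2)[OF t]] pos dx by auto
    show "x1 (u t) \<noteq> 0" using u(1)[OF sub(2)[OF t]] pos by fastforce
    have "continuous_on {x p<..<x q} u" using u_cont by (rule continuous_on_subset) auto
    then show "isCont u t" using sub(1)[OF t] by (simp add: continuous_on_eq_continuous_at)
  qed (use sub[OF t] u in auto)
  define f where "f t = y (u t)" for t
  define f' where "f' t = y1 (u t) / x1 (u t)" for t
  define f'' where "f'' t = k (u t) / (x1 (u t))\<^sup>2 * inverse (x1 (u t))" for t
  have u_pos: "u t \<in> I" "x1 (u t) > 0" "k (u t) > 0" if "t \<in> {l..r}" for t
    using u(1)[OF sub(2)[OF that]] pos by auto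
  have "u 0 = s" using ux[of s] pq \<open>x s = 0\<close> by simp
  have "convex_graph f f' f'' l r"
  proof
    fix t assume t: "t \<in> {l..r}"
    note P = u_pos[OF t]
    show "(f has_real_derivative f' t) (at t)"
      unfolding f_def[abs_def] f'_def
      using DERIV_chain2[OF dy[OF P(1)] du[OF t]] by (simp add: divide_inverse)
    have "((\<lambda>t. y1 t / x1 t) has_real_derivative k (u t) / (x1 (u t))\<^sup>2) (at (u t))"
      using DERIV_divide[OF dy1[OF P(1)] dx1[OF P(1)]] P by (simp add: k_def power2_eq_square)
    from DERIV_chain2[where f = "\<lambda>t. y1 t / x1 t" and g = u and x = t, OF this du[OF t]]
    show "(f' has_real_derivative f'' t) (at t)"
      unfolding f'_def[abs_def] f''_def .
    show "f'' t > 0" using P by (simp add: f''_def)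
  qed
  moreover have "f 0 = 0" "f' 0 = 0" using \<open>u 0 = s\<close> \<open>y s = 0\<close> \<open>y1 s = 0\<close> by (auto simp: f_def f'_def)
  ultimately have fg: "framed_graph f f' f'' l r e1 e2"
    using lr orthonormal_frame_axioms by (simp add: framed_graph_def framed_graph_axioms_def)
  interpret framed_graph f f' f'' l r e1 e2 "X s" by (rule fg)
  have "curve_chart X X1 X2 N I s f f' f'' l r u"
    unfolding curve_chart_def
  proof (intro conjI)
    show "strict_curve X X1 X2 N I" by (rule strict_curve_axioms)
    show "framed_graph f f' f'' l r (X1 s /\<^sub>R norm (X1 s)) (N s)" using fg by (simp add: e1_def e2_def)
    show "curve_chart_axioms X X1 N I s f f' l r u"
      unfolding curve_chart_axioms_def e1_def[symmetric] e2_def[symmetric]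
    proof (intro conjI allI impI)
      show "continuous_on {l..r} u" using u_cont by (rule continuous_on_subset) (use sub in auto)
      show "u a < u b" if "l \<le> a" "a < b" "b \<le> r" for a b
      proof (rule ccontr)
        assume "\<not> u a < u b"
        moreover have "u a \<in> {p..q}" "u b \<in> {p..q}" "x (u a) = a" "x (u b) = b"
          using u sub that by auto
        ultimately show False using x_less[of "u b" "u a"] that by (cases "u a = u b") auto
      qed
      fix t assume t: "t \<in> {l..r}"
      note P = u_pos[OF t]
      show "u t \<in> I" by (rule P)
      have "X (u t) - X s = t *\<^sub>R e1 + f t *\<^sub>R e2"
        using expand[of "X (u t) - X s"] u(2)[OF sub(2)[OF t]] by (simp add: f_def flip: x_def y_def)
      then show "X (u t) = pt t" by (simp add: pt_def algebra_simps)
      define n where "n = N (u t) \<bullet> e2"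
      have X1u: "X1 (u t) = x1 (u t) *\<^sub>R e1 + y1 (u t) *\<^sub>R e2" unfolding x1_def y1_def by (rule expand)
      have "0 = N (u t) \<bullet> X1 (u t)" using normal[OF P(1)] by simp
      also have "\<dots> = x1 (u t) * (N (u t) \<bullet> e1) + y1 (u t) * n"
        by (subst X1u) (simp add: inner_add_right n_def)
      finally have n1: "N (u t) \<bullet> e1 = - f' t * n" using P by (simp add: f'_def field_simps)
      have "1 = (norm (N (u t)))\<^sup>2" using unit_normal[OF P(1)] by simp
      also have "\<dots> = (1 + (f' t)\<^sup>2) * n\<^sup>2" unfolding norm_sq n1 n_def[symmetric] by (simp add: power_mult_distrib algebra_simps)
      finally have n2: "(1 + (f' t)\<^sup>2) * n\<^sup>2 = 1" by simp
      have X2u: "X2 (u t) = x2 (u t) *\<^sub>R e1 + y2 (u t) *\<^sub>R e2" unfolding x2_def y2_def by (rule expand)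
      \<comment> \<open>Orthogonality and norm determine the normal only up to sign, and no
        continuity of \<open>N\<close> is available; the sign is read off from positive
        curvature.\<close>
      have "0 < X2 (u t) \<bullet> N (u t)" by (rule strict[OF P(1)])
      also have "\<dots> = x2 (u t) * (- f' t * n) + y2 (u t) * n"
        unfolding n1[symmetric]
        by (subst X2u) (simp add: inner_add_left n_def inner_commute[of "N (u t)"])
      also have "\<dots> = k (u t) / x1 (u t) * n" using P by (simp add: k_def f'_def field_simps)
      finally have "n > 0" using P by (simp add: zero_less_mult_iff zero_less_divide_iff)
      then have "sqrt (1 + (f' t)\<^sup>2) * n = 1"
        using n2 by (metis real_sqrt_mult real_sqrt_one real_sqrt_abs abs_of_pos)
      moreover have "sqrt (1 + (f' t)\<^sup>2) \<noteq> 0" by (simp add: add_nonneg_eq_0_iff)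
      ultimately have "n = 1 / sqrt (1 + (f' t)\<^sup>2)" by (simp add: field_simps)
      then show "N (u t) = (1 / sqrt (1 + (f' t)\<^sup>2)) *\<^sub>R (e2 - f' t *\<^sub>R e1)"
        by (intro eqI) (auto simp: inner_diff_left n1 simp flip: n_def)
    qed (use \<open>u 0 = s\<close> s in auto)
  qed
  then show ?thesis by blast
qed

section \<open>From chords to parabolas\<close>

text \<open>The square root law stated for the curve itself, without a chart: normal heights and
  true chord lengths.\<close>

definition (in strict_curve) sqrt_chords :: "real \<Rightarrow> bool" where
  "sqrt_chords s \<longleftrightarrow> (\<exists>c. \<forall>\<^sub>F h in at_right 0. \<forall>a b. chord_params X I N s h a b
     \<longrightarrow> norm (X b - X a) = c * sqrt h)"

context strict_curve begin

text \<open>The equation of the parabola is differentiated within the closed interval, so that the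
  conclusion includes the ends of an arc, which is where the parabola has to be continued.\<close>

lemma parabola_tangent:
  assumes ab: "a < b" "t \<in> {a..b}" "{a..b} \<subseteq> I" "X ` {a..b} \<subseteq> quad_parabola P v w"
  shows "2 * ((X t - P) \<bullet> v) * (X1 t \<bullet> v) = X1 t \<bullet> w"
proof -
  let ?F = "\<lambda>t. ((X t - P) \<bullet> v)\<^sup>2 - (X t - P) \<bullet> w"
  have "t \<in> I" using ab by auto
  have 1: "(?F has_vector_derivative 2 * ((X t - P) \<bullet> v) * (X1 t \<bullet> v) - X1 t \<bullet> w) (at t within {a..b})"
    unfolding has_real_derivative_iff_has_vector_derivative[symmetric]
    by (rule has_field_derivative_at_within) (auto intro!: derivative_eq_intros inner_deriv \<open>t \<in> I\<close>)
  have 2: "(?F has_vector_derivative 0) (at t within {a..b})"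
    by (rule has_vector_derivative_transform[of t "{a..b}" ?F "\<lambda>_. 0"])
       (use ab in \<open>auto simp: quad_parabola_def image_subset_iff\<close>)
  have "2 * ((X t - P) \<bullet> v) * (X1 t \<bullet> v) - X1 t \<bullet> w = 0"
    by (rule vector_derivative_unique_within_closed_interval[of a b t ?F]) (use 1 2 ab in simp_all)
  then show ?thesis by simp
qed

end

context curve_chart begin

definition e1 :: "real^2" where "e1 = X1 s /\<^sub>R norm (X1 s)"

lemma e1_frame: "orthonormal_frame e1 (N s)"
  unfolding e1_def by (rule tangent_frame[OF s])

lemmas inner_e1 [simp] = orthonormal_frame.inner_frame[OF e1_frame]
lemma pt_e1: "pt t = X s + (t *\<^sub>R e1 + f t *\<^sub>R N s)"
  by (simp only: pt_def e1_def)

text \<open>The conversion factor at base point \<open>t\<close>: it divides vertical gaps to give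
  normal distances and multiplies abscissa widths of chords parallel to the tangent at
  \<open>t\<close> to give lengths.\<close>

definition q :: "real \<Rightarrow> real" where "q t = sqrt (1 + (f' t)\<^sup>2)"

lemma q: "q t > 0" "(q t)\<^sup>2 = 1 + (f' t)\<^sup>2"
  by (auto simp: q_def intro: add_pos_nonneg)

lemma gap_eq_height:
  assumes "t \<in> {l..r}" "v \<in> {l..r}"
  shows "(X (u t) - X (u v)) \<bullet> N (u v) = gap t v / q v"
proof -
  have "pt t - pt v = (t - v) *\<^sub>R e1 + (f t - f v) *\<^sub>R N s"
    by (simp add: pt_e1 algebra_simps)
  then show ?thesis
    by (simp only: X_u[OF assms(1)] X_u[OF assms(2)] N_u[OF assms(2)] inner_add_left inner_diff_right
        inner_scaleR_left inner_scaleR_right inner_e1 e1_def[symmetric])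
       (simp add: gap_def q_def algebra_simps diff_divide_distrib)
qed

lemma norm_chord:
  assumes "a \<in> {l..r}" "b \<in> {l..r}" "a \<le> b" "gap a v = gap b v"
  shows "norm (X (u b) - X (u a)) = (b - a) * q v"
proof -
  have "pt b - pt a = (b - a) *\<^sub>R e1 + (f b - f a) *\<^sub>R N s"
    by (simp add: pt_e1 algebra_simps)
  moreover have "f b - f a = f' v * (b - a)" using assms(4) by (simp add: gap_def algebra_simps)
  ultimately have "(pt b - pt a) \<bullet> e1 = b - a" "(pt b - pt a) \<bullet> N s = f' v * (b - a)"
    by (simp_all add: inner_add_left)
  then have "(norm (pt b - pt a))\<^sup>2 = ((b - a) * q v)\<^sup>2"
    unfolding orthonormal_frame.norm_sq[OF e1_frame]
    by (simp only: power_mult_distrib q(2)) (simp add: algebra_simps)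
  then have "norm (pt b - pt a) = (b - a) * q v"
    using assms(3) q(1)[of v] by (simp add: power2_eq_iff_nonneg)
  then show ?thesis by (simp only: X_u[OF assms(1)] X_u[OF assms(2)])
qed

lemma u_surj:
  assumes "l \<le> a" "a \<le> b" "b \<le> r" "z \<in> {u a..u b}"
  obtains x where "x \<in> {a..b}" "u x = z"
  using IVT'[of u a z b] continuous_on_subset[OF u_cont, of "{a..b}"] assms by auto

lemma u_le: "\<lbrakk>l \<le> a; a \<le> b; b \<le> r\<rbrakk> \<Longrightarrow> u a \<le> u b"
  using u_less[of a b] by (cases "a = b") auto

lemma u_image:
  assumes "l \<le> a" "a \<le> b" "b \<le> r" shows "u ` {a..b} = {u a..u b}"
proof (intro set_eqI iffI)
  fix z assume "z \<in> {u a..u b}"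
  then show "z \<in> u ` {a..b}" using u_surj[OF assms] by blast
qed (use assms u_le in auto)

lemma chord_params_branches:
  assumes v: "l < v" "v < r" and h: "0 < h" "h < gap l v" "h < gap r v"
  shows "chord_params X I N (u v) (h / q v) (u (lt v h)) (u (rt v h))"
proof -
  have e: "l < lt v h" "lt v h < v" "v < rt v h" "rt v h < r" "gap (lt v h) v = h" "gap (rt v h) v = h"
    using lt_strict[of v h] rt_strict[of v h] lt[of v h] rt[of v h] v h by auto
  have on: "X (u t) \<in> cutting_line X N (u v) (h / q v) \<longleftrightarrow> gap t v = h" if "t \<in> {l..r}" for t
    using that v q(1)[of v] by (simp add: mem_cutting_line u_mem gap_eq_height)
  have "z \<notin> {u (lt v h)<..<u (rt v h)}" if "X z \<in> cutting_line X N (u v) (h / q v)" for z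
  proof
    assume z: "z \<in> {u (lt v h)<..<u (rt v h)}"
    then obtain x where x: "x \<in> {lt v h..rt v h}" "u x = z"
      using u_surj[of "lt v h" "rt v h" z] e v by auto
    then have x': "lt v h < x" "x < rt v h" using z by (auto simp: less_le)
    have "gap x v = h" using that on[of x] x e by auto
    then show False
      using gap_less_right[of v x "rt v h"] gap_less_left[of "lt v h" x v] x' e v
      by (cases "v \<le> x") auto
  qed
  then show ?thesis
    unfolding chord_params_def
    using e v u_less on Icc_subset u_mem by auto
qed

text \<open>Heights and lengths scale by powers of \<open>q v\<close>, which is fixed with the base
  point, so the constants on the two sides differ by the factor q sqrt q. For small heights the
  chord exists and is unique, so the quantifier over all chords refers to the one given by
  \<open>lt\<close> and \<open>rt\<close>.\<close>

lemma sqrt_chords_iff: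
  assumes v: "l < v" "v < r"
  shows "sqrt_chords (u v) \<longleftrightarrow> (\<exists>c. \<exists>H>0. sqrt_width v c H)"
proof
  assume "sqrt_chords (u v)"
  then obtain c H0 where H0: "H0 > 0" "\<And>h a b. \<lbrakk>0 < h; h < H0; chord_params X I N (u v) h a b\<rbrakk>
      \<Longrightarrow> norm (X b - X a) = c * sqrt h"
    unfolding sqrt_chords_def eventually_at_right_field by blast
  define H where "H = Min {H0 * q v, gap l v, gap r v}"
  have g: "gap l v > 0" "gap r v > 0" using gap_pos v by auto
  then have H: "H > 0" "H \<le> H0 * q v" "H \<le> gap l v" "H \<le> gap r v" using H0 q(1)[of v] by (auto simp: H_def)
  have "sqrt_width v (c / sqrt (q v) / q v) H"
    unfolding sqrt_width_def
  proof (intro allI impI)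
    fix a b assume *: "l \<le> a \<and> a < v \<and> v < b \<and> b \<le> r \<and> gap a v = gap b v \<and> gap b v < H"
    define h where "h = gap b v"
    have h: "0 < h" "h < H" using * gap_pos[of b v] v by (auto simp: h_def)
    have ab: "lt v h = a" "rt v h = b" using * v by (auto simp: h_def intro: lt_eqI rt_eqI)
    have "chord_params X I N (u v) (h / q v) (u a) (u b)"
      using chord_params_branches[OF v, of h] h H by (simp add: ab)
    moreover have "h / q v < H0" using h H q(1)[of v] by (simp add: pos_divide_less_eq)
    ultimately have "norm (X (u b) - X (u a)) = c * sqrt (h / q v)"
      using h q(1)[of v] by (intro H0(2)) auto
    moreover have "norm (X (u b) - X (u a)) = (b - a) * q v" using * v by (intro norm_chord) auto
    ultimately show "b - a = c / sqrt (q v) / q v * sqrt (gap b v)"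
      using q(1)[of v] by (simp add: real_sqrt_divide field_simps flip: h_def)
  qed
  then show "\<exists>c. \<exists>H>0. sqrt_width v c H" using H by blast
next
  assume "\<exists>c. \<exists>H>0. sqrt_width v c H"
  then obtain c H0 where H0: "H0 > 0" "sqrt_width v c H0" by auto
  have g: "gap l v > 0" "gap r v > 0" using gap_pos v by auto
  define H where "H = Min {H0, gap l v, gap r v} / q v"
  have "H > 0" using H0 g q(1)[of v] by (auto simp: H_def)
  moreover have "norm (X b - X a) = c * q v * sqrt (q v) * sqrt h"
    if h: "0 < h" "h < H" and ch: "chord_params X I N (u v) h a b" for h a b
  proof -
    define k where "k = h * q v"
    have "k < Min {H0, gap l v, gap r v}" using h q(1)[of v] by (simp add: H_def k_def pos_less_divide_eq)
    then have k: "0 < k" "k < H0" "k < gap l v" "k < gap r v" using h q(1)[of v] by (auto simp: k_def)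
    have "k / q v = h" using q(1)[of v] by (simp add: k_def)
    with chord_params_branches[OF v k(1,3,4)] have ch': "chord_params X I N (u v) h (u (lt v k)) (u (rt v k))" by simp
    note ab = chord_params_unique[OF ch ch']
    have e: "l < lt v k" "lt v k < v" "v < rt v k" "rt v k < r" "gap (lt v k) v = k" "gap (rt v k) v = k"
      using lt_strict[of v k] rt_strict[of v k] lt[of v k] rt[of v k] v k by auto
    have "norm (X b - X a) = (rt v k - lt v k) * q v"
      unfolding ab using e by (intro norm_chord) auto
    also have "rt v k - lt v k = c * sqrt k" using H0 v k by (intro sqrt_widthD)
    finally show ?thesis by (simp add: k_def real_sqrt_mult)
  qed
  ultimately show "sqrt_chords (u v)"
    unfolding sqrt_chords_def eventually_at_right_field by blast
qed

lemma centroid_dist_eq: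
  assumes h: "0 < h" "h < f l" "h < f r"
  shows "centroid_dist X I N s h = M (\<lambda>y. y) h / M (\<lambda>y. 1) h"
proof -
  have "q 0 = 1" by (simp add: q_def vertex)
  then have "chord_params X I N s h (u (lt 0 h)) (u (rt 0 h))"
    using chord_params_branches[of 0 h] bounds h by (simp add: u0)
  from curve_section_eq[OF this]
  have "curve_section X I N s h = inside (pt ` {lt 0 h..rt 0 h} \<union> closed_segment (pt (lt 0 h)) (pt (rt 0 h)))"
  proof -
    note e = ends[OF h]
    have "X ` {u (lt 0 h)..u (rt 0 h)} = pt ` {lt 0 h..rt 0 h}"
      using u_image[of "lt 0 h" "rt 0 h", symmetric] e by (auto simp: image_image X_u intro!: image_cong)
    moreover have "X (u (lt 0 h)) = pt (lt 0 h)" "X (u (rt 0 h)) = pt (rt 0 h)" using e by (auto intro: X_u)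
    ultimately show ?thesis using \<open>curve_section X I N s h = _\<close> by simp
  qed
  then have "centroid_dist X I N s h = \<bar>M (\<lambda>y. y) h / M (\<lambda>y. 1) h\<bar>"
    unfolding centroid_dist_def infdist_tangent_line[OF s] by (simp only: centroid_height[OF h])
  moreover have "M (\<lambda>y. y) h > 0" "M (\<lambda>y. 1) h > 0" using h by (auto intro!: M_pos simp: continuous_on_id)
  ultimately show ?thesis by simp
qed

lemma centroid_condition_iff:
  "(\<forall>\<^sub>F h in at_right 0. centroid_dist X I N s h = 3 / 5 * h) \<longleftrightarrow> sqrt_chords s"
proof -
  have "\<forall>\<^sub>F h in at_right 0. h \<in> {0<..<min (f l) (f r)}"
    using height_pos by (intro eventually_at_right_real) auto
  then have "\<forall>\<^sub>F h in at_right 0. (centroid_dist X I N s h = 3 / 5 * h) = (M (\<lambda>y. y) h / M (\<lambda>y. 1) h = 3 / 5 * h)"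
    by eventually_elim (simp add: centroid_dist_eq)
  then have "(\<forall>\<^sub>F h in at_right 0. centroid_dist X I N s h = 3 / 5 * h) \<longleftrightarrow>
      (\<forall>\<^sub>F h in at_right 0. M (\<lambda>y. y) h / M (\<lambda>y. 1) h = 3 / 5 * h)"
    by (rule eventually_subst)
  also have "\<dots> \<longleftrightarrow> sqrt_chords s"
    using centroid_iff_sqrt_width sqrt_chords_iff[of 0] bounds by (simp add: u0)
  finally show ?thesis .
qed

lemma tangent_form:
  assumes ind: "independent2 v w" and ab: "a < b" "s \<in> {a..b}" "{a..b} \<subseteq> I" "X ` {a..b} \<subseteq> quad_parabola P v w"
  obtains al be ga where "al \<noteq> 0"
    "\<And>t. t \<in> {l..r} \<Longrightarrow> X (u t) \<in> quad_parabola P v w \<longleftrightarrow> (al * t + be * f t)\<^sup>2 = ga * f t"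
proof -
  have "2 * ((X s - P) \<bullet> v) * (X1 s \<bullet> v) = X1 s \<bullet> w" by (rule parabola_tangent[OF ab])
  then have "2 * ((X s - P) \<bullet> v) * (e1 \<bullet> v) = e1 \<bullet> w" by (simp add: e1_def)
  moreover have "X s \<in> quad_parabola P v w" using ab by auto
  moreover have "e1 \<noteq> 0" using inner_e1(1) by force
  ultimately obtain al be ga where "al \<noteq> 0" and
    *: "\<And>x h. X s + (x *\<^sub>R e1 + h *\<^sub>R N s) \<in> quad_parabola P v w \<longleftrightarrow> (al * x + be * h)\<^sup>2 = ga * h"
    using quad_parabola_tangent_form[OF ind, of "X s" P e1 "N s"] by blast
  show ?thesis
    by (rule that[OF \<open>al \<noteq> 0\<close>, of be ga]) (simp only: X_u pt_e1 *)
qed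

text \<open>At height h both ends satisfy the same equation (al x + be h)^2 = ga h. Being distinct,
  they are its two roots, and the shear be h cancels in their difference.\<close>

lemma parabola_imp_sqrt_chords:
  assumes ind: "independent2 v w" and "X ` I \<subseteq> quad_parabola P v w"
  shows "sqrt_chords s"
proof -
  have sI: "u l < s" "s < u r" "{u l..u r} \<subseteq> I"
    using u_less[of l 0] u_less[of 0 r] bounds u0 Icc_subset u_mem by auto
  have sm: "s \<in> {u l..u r}" using sI by auto
  have im: "X ` {u l..u r} \<subseteq> quad_parabola P v w" using sI(3) assms(2) by blast
  obtain al be ga where "al \<noteq> 0" and
    *: "\<And>t. t \<in> {l..r} \<Longrightarrow> X (u t) \<in> quad_parabola P v w \<longleftrightarrow> (al * t + be * f t)\<^sup>2 = ga * f t"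
    using tangent_form[OF ind less_trans[OF sI(1,2)] sm sI(3) im] by blast
  \<comment> \<open>The height bound 1 is arbitrary, since the equation holds on the whole
    chart.\<close>
  have "sqrt_width 0 (2 * sqrt ga / \<bar>al\<bar>) 1"
    unfolding sqrt_width_def
  proof (intro allI impI)
    fix a b assume ab: "l \<le> a \<and> a < 0 \<and> 0 < b \<and> b \<le> r \<and> gap a 0 = gap b 0 \<and> gap b 0 < 1"
    define h where "h = f b"
    have "f a = h" using ab by (simp add: h_def)
    have "h > 0" using gap_pos[of b 0] ab bounds by (auto simp: h_def)
    have A: "(al * a + be * h)\<^sup>2 = ga * h" and B: "(al * b + be * h)\<^sup>2 = ga * h"
      using *[of a] *[of b] ab u_mem assms(2) \<open>f a = h\<close> by (auto simp: h_def image_subset_iff)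
    have "al * a + be * h \<noteq> al * b + be * h" using ab \<open>al \<noteq> 0\<close> by auto
    then have "al * a + be * h = - (al * b + be * h)"
      using A B power2_eq_iff[of "al * a + be * h" "al * b + be * h"] by metis
    then have "al * (b - a) = 2 * (al * b + be * h)" by (simp add: algebra_simps)
    then have "\<bar>al * (b - a)\<bar> = \<bar>2 * (al * b + be * h)\<bar>" by (rule arg_cong)
    then have "\<bar>al\<bar> * (b - a) = 2 * \<bar>al * b + be * h\<bar>" using ab unfolding abs_mult by simp
    also have "\<bar>al * b + be * h\<bar> = sqrt (ga * h)" by (simp flip: B)
    finally have "b - a = 2 * sqrt (ga * h) / \<bar>al\<bar>" using \<open>al \<noteq> 0\<close> by (simp add: field_simps)
    then show "b - a = 2 * sqrt ga / \<bar>al\<bar> * sqrt (gap b 0)" by (simp add: real_sqrt_mult flip: h_def)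
  qed
  then show ?thesis using sqrt_chords_iff[of 0] bounds u0 by (auto intro: zero_less_one)
qed

lemma parabola_somewhere:
  assumes "\<And>t. t \<in> I \<Longrightarrow> sqrt_chords t"
  obtains P v w a b where "independent2 v w" "a < b" "{a..b} \<subseteq> I" "X ` {a..b} \<subseteq> quad_parabola P v w"
proof -
  have "\<exists>c. \<exists>H>0. sqrt_width t c H" if "l < t" "t < r" for t
    using sqrt_chords_iff[OF that] assms[OF u_mem[of t]] that by simp
  from sqrt_width_imp_parabola_somewhere[OF less_trans[OF bounds] this]
  obtain m d be ga where d: "d > 0" "m - d \<ge> l" "m + d \<le> r" and
    par: "\<And>t. t \<in> {m-d..m+d} \<Longrightarrow> ((t - m) + be * gap t m)\<^sup>2 = ga * gap t m"
    by blast
  \<comment> \<open>A multiple of the normal at \<open>m\<close>, scaled so that the inner product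
    with it is exactly the vertical gap over \<open>m\<close>.\<close>
  define n where "n = N s - f' m *\<^sub>R e1"
  define v where "v = e1 + be *\<^sub>R n"
  define w where "w = ga *\<^sub>R n"
  have ne: "n \<bullet> e1 = - f' m" "n \<bullet> N s = 1" "e1 \<bullet> n = - f' m" "N s \<bullet> n = 1"
    by (auto simp: n_def inner_diff_left inner_diff_right)
  \<comment> \<open>With \<open>ga\<close> zero, \<open>be\<close> times a positive gap would have
    to equal -d on one side of \<open>m\<close> and d on the other.\<close>
  have "ga \<noteq> 0"
  proof
    assume "ga = 0"
    then have "d + be * gap (m + d) m = 0" "- d + be * gap (m - d) m = 0"
      using par[of "m + d"] par[of "m - d"] d by auto
    moreover have "gap (m + d) m > 0" "gap (m - d) m > 0" using gap_pos d by auto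
    ultimately show False using d by (smt (verit) mult_nonneg_nonneg mult_nonpos_nonneg)
  qed
  then have "independent2 v w"
    by (intro orthonormal_frame.independent2I[OF e1_frame])
       (simp add: v_def w_def inner_add_left ne algebra_simps)
  moreover have "X (u t) \<in> quad_parabola (X (u m)) v w" if t: "t \<in> {m-d..m+d}" for t
  proof -
    have lr: "t \<in> {l..r}" "m \<in> {l..r}" using t d by auto
    have "X (u t) - X (u m) = (t - m) *\<^sub>R e1 + (f t - f m) *\<^sub>R N s"
      unfolding X_u[OF lr(1)] X_u[OF lr(2)] by (simp add: pt_e1 algebra_simps)
    then have "(X (u t) - X (u m)) \<bullet> e1 = t - m" "(X (u t) - X (u m)) \<bullet> n = gap t m"
      by (simp_all add: inner_add_left ne gap_def)
    then show ?thesis using par[OF t]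
      by (simp only: quad_parabola_def v_def w_def mem_Collect_eq inner_add_right inner_scaleR_right)
  qed
  then have "X ` (u ` {m-d..m+d}) \<subseteq> quad_parabola (X (u m)) v w" by auto
  then have "X ` {u (m-d)..u (m+d)} \<subseteq> quad_parabola (X (u m)) v w"
    using u_image[of "m-d" "m+d"] d by simp
  moreover have "u (m-d) < u (m+d)" using d by (intro u_less) auto
  moreover have "{u (m-d)..u (m+d)} \<subseteq> I" using d by (intro Icc_subset u_mem) auto
  ultimately show ?thesis using that by blast
qed

lemma extend_parabola_right:
  assumes ind: "independent2 v w" and a: "a < s" "a \<in> I" "X ` {a..s} \<subseteq> quad_parabola P v w"
    and "sqrt_chords s"
  shows "\<exists>d>0. X ` {s..s+d} \<subseteq> quad_parabola P v w"
proof -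
  obtain al be ga where "al \<noteq> 0" and
    *: "\<And>t. t \<in> {l..r} \<Longrightarrow> X (u t) \<in> quad_parabola P v w \<longleftrightarrow> (al * t + be * f t)\<^sup>2 = ga * f t"
    using tangent_form[OF ind a(1), of P] a Icc_subset s by auto
  obtain c H where "H > 0" "sqrt_width 0 c H" using assms sqrt_chords_iff[of 0] bounds u0 by auto
  \<comment> \<open>The known arc reaches back either beyond the chart or only to \<open>a\<close>;
    \<open>e\<close> measures the part of it that is visible in the chart.\<close>
  moreover obtain e where e: "e > 0" "e \<le> - l" "a \<le> u (- e)"
  proof (cases "a \<le> u l")
    case True
    then show ?thesis using that[of "- l"] bounds by auto
  next
    case False
    then obtain x where "x \<in> {l..0}" "u x = a" using u_surj[of l 0 a] bounds a u0 by auto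
    then show ?thesis using that[of "- x"] a u0 by (cases "x = 0") auto
  qed
  have "(al * (t - 0) + be * gap t 0)\<^sup>2 = ga * gap t 0" if "0 - e \<le> t" "t \<le> 0" "l \<le> t" for t
  proof -
    have "u t \<in> {a..s}" using u_le[of "- e" t] u_le[of t 0] that e bounds u0 by auto
    then have "X (u t) \<in> quad_parabola P v w" using a by blast
    then show ?thesis using *[of t] that bounds by auto
  qed
  from extend_right[OF bounds \<open>sqrt_width 0 c H\<close> \<open>H > 0\<close> \<open>e > 0\<close> \<open>al \<noteq> 0\<close> this]
  obtain d where d: "d > 0" "\<And>t. 0 \<le> t \<Longrightarrow> t \<le> d \<Longrightarrow> (al * t + be * f t)\<^sup>2 = ga * f t"
    by auto
  define d' where "d' = min d r"
  have d': "0 < d'" "d' \<le> r" "d' \<le> d" using d bounds by (auto simp: d'_def)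
  have "X ` (u ` {0..d'}) \<subseteq> quad_parabola P v w" using d' d bounds * by auto
  then have "X ` {s..u d'} \<subseteq> quad_parabola P v w" using u_image[of 0 d'] d' bounds u0 by simp
  moreover have "u d' > s" using u_less[of 0 d'] d' bounds u0 by auto
  ultimately show ?thesis by (intro exI[of _ "u d' - s"]) auto
qed

lemma extend_parabola_left:
  assumes ind: "independent2 v w" and a: "s < a" "a \<in> I" "X ` {s..a} \<subseteq> quad_parabola P v w"
    and "sqrt_chords s"
  shows "\<exists>d>0. X ` {s-d..s} \<subseteq> quad_parabola P v w"
proof -
  obtain al be ga where "al \<noteq> 0" and
    *: "\<And>t. t \<in> {l..r} \<Longrightarrow> X (u t) \<in> quad_parabola P v w \<longleftrightarrow> (al * t + be * f t)\<^sup>2 = ga * f t"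
    using tangent_form[OF ind a(1), of P] a Icc_subset s by auto
  obtain c H where "H > 0" "sqrt_width 0 c H" using assms sqrt_chords_iff[of 0] bounds u0 by auto
  moreover obtain e where e: "e > 0" "e \<le> r" "u e \<le> a"
  proof (cases "u r \<le> a")
    case True
    then show ?thesis using that[of r] bounds by auto
  next
    case False
    then obtain x where "x \<in> {0..r}" "u x = a" using u_surj[of 0 r a] bounds a u0 by auto
    then show ?thesis using that[of x] a u0 by (cases "x = 0") auto
  qed
  have "(al * (t - 0) + be * gap t 0)\<^sup>2 = ga * gap t 0" if "0 \<le> t" "t \<le> 0 + e" "t \<le> r" for t
  proof -
    have "u t \<in> {s..a}" using u_le[of t e] u_le[of 0 t] that e bounds u0 by auto
    then have "X (u t) \<in> quad_parabola P v w" using a by blast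
    then show ?thesis using *[of t] that bounds by auto
  qed
  from extend_left[OF bounds \<open>sqrt_width 0 c H\<close> \<open>H > 0\<close> \<open>e > 0\<close> \<open>al \<noteq> 0\<close> this]
  obtain d where d: "d > 0" "\<And>t. - d \<le> t \<Longrightarrow> t \<le> 0 \<Longrightarrow> (al * t + be * f t)\<^sup>2 = ga * f t"
    by auto
  define d' where "d' = min d (- l)"
  have d': "0 < d'" "l \<le> - d'" "- d \<le> - d'" using d bounds by (auto simp: d'_def)
  have "X ` (u ` {-d'..0}) \<subseteq> quad_parabola P v w" using d' d bounds * by auto
  then have "X ` {u (-d')..s} \<subseteq> quad_parabola P v w" using u_image[of "-d'" 0] d' bounds u0 by simp
  moreover have "u (-d') < s" using u_less[of "-d'" 0] d' bounds u0 by auto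
  ultimately show ?thesis by (intro exI[of _ "s - u (-d')"]) auto
qed

end

text \<open>Induction along the real line: the supremum of the points up to which \<open>Q\<close>
  holds is attained by the limit rule, and the step rule would push it further unless it is
  \<open>b\<close>.\<close>

lemma real_interval_induct:
  fixes a c b :: real
  assumes "a \<le> c" and base: "\<And>z. \<lbrakk>a \<le> z; z \<le> c; z \<le> b\<rbrakk> \<Longrightarrow> Q z"
    and step: "\<And>x. \<lbrakk>c \<le> x; x < b; \<forall>z\<in>{a..x}. Q z\<rbrakk> \<Longrightarrow> \<exists>d>0. \<forall>z\<in>{x..x+d}. Q z"
    and limit: "\<And>x. \<lbrakk>c < x; x \<le> b; \<forall>z\<in>{a..<x}. Q z\<rbrakk> \<Longrightarrow> Q x"
  shows "\<forall>z\<in>{a..b}. Q z"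
proof (cases "c < b")
  case True
  define B where "B = {x \<in> {c..b}. \<forall>z\<in>{a..x}. Q z}"
  define m where "m = Sup B"
  have cB: "c \<in> B" using base True by (auto simp: B_def)
  have bdd: "bdd_above B" by (auto simp: B_def bdd_above_def)
  have m: "c \<le> m" "m \<le> b"
    unfolding m_def using cB bdd by (auto intro: cSup_upper cSup_least simp: B_def)
  have below: "\<forall>z\<in>{a..<m}. Q z"
  proof
    fix z assume "z \<in> {a..<m}"
    then obtain x where "x \<in> B" "z < x" using less_cSupD[of B z] cB by (auto simp: m_def)
    then show "Q z" using \<open>z \<in> {a..<m}\<close> by (auto simp: B_def)
  qed
  then have "Q m" using base[of m] limit[of m] m \<open>a \<le> c\<close> by (cases "m = c") auto
  with below have mB: "\<forall>z\<in>{a..m}. Q z" by (auto simp: less_le)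
  show ?thesis
  proof (cases "m = b")
    case False
    then obtain d where d: "d > 0" "\<forall>z\<in>{m..m+d}. Q z" using step[of m] m mB by auto
    have "Q z" if "z \<in> {a..min (m + d) b}" for z
      using that d(2) mB by (cases "z \<le> m") auto
    then have "min (m + d) b \<in> B" using m d(1) by (auto simp: B_def)
    then have "min (m + d) b \<le> m" unfolding m_def by (rule cSup_upper[OF _ bdd])
    then show ?thesis using d False m by auto
  qed (use mB in simp)
qed (use base in auto)

lemma closed_quad_parabola: "closed (quad_parabola P v w)"
  unfolding quad_parabola_def by (intro closed_Collect_eq continuous_intros)

section \<open>Continuation of the parabola along the whole curve\<close>

context strict_curve begin

lemma quad_parabola_limit:
  assumes "x \<in> I" "a < x" "X ` {a..<x} \<subseteq> quad_parabola P v w"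
  shows "X x \<in> quad_parabola P v w"
proof (rule Lim_in_closed_set[OF closed_quad_parabola])
  have "isCont X x" using cont_X open_I assms(1) by (simp add: continuous_on_eq_continuous_at)
  then show "(X \<longlongrightarrow> X x) (at_left x)" by (auto simp: isCont_def intro: filterlim_mono at_le)
  have "\<forall>\<^sub>F t in at_left x. t \<in> {a<..<x}" using assms(2) by (rule eventually_at_left_real)
  then show "\<forall>\<^sub>F t in at_left x. X t \<in> quad_parabola P v w"
    by eventually_elim (use assms(3) in auto)
qed auto

lemma quad_parabola_limit':
  assumes "x \<in> I" "x < a" "X ` {x<..a} \<subseteq> quad_parabola P v w"
  shows "X x \<in> quad_parabola P v w"
proof (rule Lim_in_closed_set[OF closed_quad_parabola])
  have "isCont X x" using cont_X open_I assms(1) by (simp add: continuous_on_eq_continuous_at)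
  then show "(X \<longlongrightarrow> X x) (at_right x)" by (auto simp: isCont_def intro: filterlim_mono at_le)
  have "\<forall>\<^sub>F t in at_right x. t \<in> {x<..<a}" using assms(2) by (rule eventually_at_right_real)
  then show "\<forall>\<^sub>F t in at_right x. X t \<in> quad_parabola P v w"
    by eventually_elim (use assms(3) in auto)
qed auto

lemma sqrt_chords_imp_parabola:
  assumes "I \<noteq> {}" and sq: "\<And>t. t \<in> I \<Longrightarrow> sqrt_chords t"
  obtains P v w where "independent2 v w" "X ` I \<subseteq> quad_parabola P v w"
proof -
  obtain s0 where "s0 \<in> I" using assms by auto
  then obtain f f' f'' l r u where "curve_chart X X1 X2 N I s0 f f' f'' l r u"
    using chart_exists by blast
  then interpret c0: curve_chart X X1 X2 N I s0 f f' f'' l r u .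
  obtain P v w a b where ind: "independent2 v w" and ab: "a < b" "{a..b} \<subseteq> I" "X ` {a..b} \<subseteq> quad_parabola P v w"
    using c0.parabola_somewhere[OF sq] by metis
  have abI: "a \<in> I" "b \<in> I" using ab by auto
  have right: "X y \<in> quad_parabola P v w" if y: "y \<in> I" "a \<le> y" for y
  proof -
    have "\<forall>z\<in>{a..y}. X z \<in> quad_parabola P v w"
    proof (rule real_interval_induct[of a b])
      fix x assume x: "b \<le> x" "x < y" "\<forall>z\<in>{a..x}. X z \<in> quad_parabola P v w"
      then have "x \<in> I" using Icc_subset[OF abI(2) y(1)] by auto
      then obtain f f' f'' l r u where "curve_chart X X1 X2 N I x f f' f'' l r u"
        using chart_exists by blast
      then interpret c: curve_chart X X1 X2 N I x f f' f'' l r u .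
      have "\<exists>d>0. X ` {x..x+d} \<subseteq> quad_parabola P v w"
        using x ab abI sq[OF \<open>x \<in> I\<close>] by (intro c.extend_parabola_right[OF ind, of a]) auto
      then show "\<exists>d>0. \<forall>z\<in>{x..x+d}. X z \<in> quad_parabola P v w" by auto
    next
      fix x assume x: "b < x" "x \<le> y" "\<forall>z\<in>{a..<x}. X z \<in> quad_parabola P v w"
      then have "x \<in> I" using Icc_subset[OF abI(2) y(1)] by auto
      then show "X x \<in> quad_parabola P v w" using x ab by (intro quad_parabola_limit[of x a]) auto
    qed (use ab in auto)
    then show ?thesis using y by auto
  qed
  have left: "X y \<in> quad_parabola P v w" if y: "y \<in> I" "y \<le> b" for y
  proof -
    \<comment> \<open>The induction principle runs upwards, so the continuation to the left is
      carried out in the reflected parameter.\<close>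
    have "\<forall>z\<in>{- b..- y}. X (- z) \<in> quad_parabola P v w"
    proof (rule real_interval_induct[of "- b" "- a"])
      fix x assume x: "- a \<le> x" "x < - y" "\<forall>z\<in>{- b..x}. X (- z) \<in> quad_parabola P v w"
      then have "- x \<in> I" using Icc_subset[OF y(1) abI(1)] by auto
      then obtain f f' f'' l r u where "curve_chart X X1 X2 N I (- x) f f' f'' l r u"
        using chart_exists by blast
      then interpret c: curve_chart X X1 X2 N I "- x" f f' f'' l r u .
      have "X z \<in> quad_parabola P v w" if "z \<in> {- x..b}" for z using x(3)[rule_format, of "- z"] that by auto
      then have "\<exists>d>0. X ` {- x - d..- x} \<subseteq> quad_parabola P v w"
        using x ab abI sq[OF \<open>- x \<in> I\<close>] by (intro c.extend_parabola_left[OF ind, of b]) auto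
      then obtain d where d: "d > 0" "X ` {- x - d..- x} \<subseteq> quad_parabola P v w" by auto
      show "\<exists>d>0. \<forall>z\<in>{x..x+d}. X (- z) \<in> quad_parabola P v w"
        using d by (intro exI[of _ d]) auto
    next
      fix x assume x: "- a < x" "x \<le> - y" "\<forall>z\<in>{- b..<x}. X (- z) \<in> quad_parabola P v w"
      then have "- x \<in> I" using Icc_subset[OF y(1) abI(1)] by auto
      moreover have "X z \<in> quad_parabola P v w" if "z \<in> {- x<..b}" for z using x(3)[rule_format, of "- z"] that by auto
      ultimately show "X (- x) \<in> quad_parabola P v w" using x ab by (intro quad_parabola_limit'[of "- x" b]) auto
    next
      fix z assume "- b \<le> z" "z \<le> - a"
      then show "X (- z) \<in> quad_parabola P v w" using ab by auto
    qed (use ab in auto)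
    then have "X (- (- y)) \<in> quad_parabola P v w" using y by (auto simp del: minus_minus)
    then show ?thesis by simp
  qed
  have "X ` I \<subseteq> quad_parabola P v w" using left right ab by (force simp: image_subset_iff)
  then show ?thesis using that ind by blast
qed

text \<open>A point of the parabola is determined by its coordinate along \<open>v\<close>, since
  that coordinate also gives the one along \<open>w\<close>. On the curve this coordinate has
  nonzero derivative, so its values fill an open set of reals, and the curve is the part of the
  parabola over that set.\<close>

lemma openin_parabola:
  assumes ind: "independent2 v w" and Q: "X ` I \<subseteq> quad_parabola P v w"
  shows "openin (top_of_set (quad_parabola P v w)) (X ` I)"
proof -
  define g where "g t = (X t - P) \<bullet> v" for t
  have "open (g ` I)"
    unfolding open_subopen[of "g ` I"]
  proof safe
    fix t assume t: "t \<in> I"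
    obtain e where e: "e > 0" "cball t e \<subseteq> I" using open_I t open_contains_cball by blast
    then have e': "{t - e..t + e} \<subseteq> I" by (simp add: cball_eq_atLeastAtMost)
    \<comment> \<open>A velocity orthogonal to \<open>v\<close> would by tangency be orthogonal to
      \<open>w\<close> too, contradicting regularity.\<close>
    have "X1 t \<bullet> v \<noteq> 0"
    proof
      assume "X1 t \<bullet> v = 0"
      with parabola_tangent[of "t - e" "t + e" t P v w] e(1) e' subset_trans[OF image_mono[OF e'] Q] have "X1 t \<bullet> w = 0" by simp
      with \<open>X1 t \<bullet> v = 0\<close> regular[OF t] independent2_zero[OF ind] show False by blast
    qed
    have "g t \<in> interior (g ` I)"
    proof (rule sussmann_open_mapping[OF open_I _ t])
      show "continuous_on I g" unfolding g_def by (intro continuous_intros cont_X)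
      show "(g has_derivative (*) (X1 t \<bullet> v)) (at t)"
        using inner_deriv[OF t] unfolding g_def has_field_derivative_def .
      show "bounded_linear (\<lambda>x::real. x / (X1 t \<bullet> v))" by (rule bounded_linear_divide)
      show "(*) (X1 t \<bullet> v) \<circ> (\<lambda>x. x / (X1 t \<bullet> v)) = id" using \<open>X1 t \<bullet> v \<noteq> 0\<close> by auto
    qed (use t open_I in \<open>auto simp: interior_open\<close>)
    then show "\<exists>T. open T \<and> g t \<in> T \<and> T \<subseteq> g ` I" by (metis interior_subset open_interior)
  qed
  then have "open ((\<lambda>p. (p - P) \<bullet> v) -` (g ` I))"
    by (rule open_vimage) (intro continuous_intros)
  moreover have "X ` I = quad_parabola P v w \<inter> (\<lambda>p. (p - P) \<bullet> v) -` (g ` I)"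
  proof (intro set_eqI iffI)
    fix p assume p: "p \<in> quad_parabola P v w \<inter> (\<lambda>p. (p - P) \<bullet> v) -` (g ` I)"
    then obtain t where t: "t \<in> I" "(p - P) \<bullet> v = (X t - P) \<bullet> v" by (auto simp: g_def)
    moreover have "X t \<in> quad_parabola P v w" using Q t by auto
    ultimately have "(p - P) \<bullet> w = (X t - P) \<bullet> w" using p by (simp add: quad_parabola_def)
    with t have "(p - X t) \<bullet> v = 0" "(p - X t) \<bullet> w = 0" by (auto simp: inner_diff_left)
    then have "p - X t = 0" by (rule independent2_zero[OF ind])
    then show "p \<in> X ` I" using t by auto
  qed (use Q in \<open>auto simp: g_def\<close>)
  ultimately show ?thesis by (metis openin_open_Int)
qed

lemma open_part_iff:
  "open_part_of_parabola (X ` I) \<longleftrightarrow> (\<exists>P v w. independent2 v w \<and> X ` I \<subseteq> quad_parabola P v w)"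
proof
  assume "open_part_of_parabola (X ` I)"
  then obtain Q where "parabola Q" "openin (top_of_set Q) (X ` I)" unfolding open_part_of_parabola_def by auto
  then show "\<exists>P v w. independent2 v w \<and> X ` I \<subseteq> quad_parabola P v w"
    using parabola_imp_quad[of Q] openin_imp_subset by metis
next
  assume "\<exists>P v w. independent2 v w \<and> X ` I \<subseteq> quad_parabola P v w"
  moreover have "connected (X ` I)"
    using interval_I by (intro connected_continuous_image cont_X is_interval_connected)
  ultimately show "open_part_of_parabola (X ` I)"
    unfolding open_part_of_parabola_def using quad_imp_parabola openin_parabola by blast
qed

lemma open_part_iff_centroid:
  assumes "I \<noteq> {}"
  shows "open_part_of_parabola (X ` I) \<longleftrightarrow>
    (\<forall>s\<in>I. \<forall>\<^sub>F h in at_right 0. centroid_dist X I N s h = 3 / 5 * h)"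
proof -
  have "(\<forall>\<^sub>F h in at_right 0. centroid_dist X I N s h = 3 / 5 * h) \<longleftrightarrow> sqrt_chords s" if "s \<in> I" for s
    using chart_exists[OF that] curve_chart.centroid_condition_iff by blast
  moreover have "sqrt_chords s" if "s \<in> I" "independent2 v w" "X ` I \<subseteq> quad_parabola P v w" for s P v w
    using chart_exists[OF that(1)] curve_chart.parabola_imp_sqrt_chords that by blast
  ultimately show ?thesis
    unfolding open_part_iff using sqrt_chords_imp_parabola[OF assms] by (metis (no_types, lifting))
qed

end

text \<open>By the chain rule the second derivative of the arc length parametrization is phi'^2 X''
  + phi'' X'. The last term is orthogonal to the normal, so the curvature is the normal part of X''
  times a square, and positivity carries over to the given parameter.\<close>

lemma strictly_locally_convex_imp_strict_curve:
  assumes "strictly_locally_convex X I N"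
  shows "strict_curve X (\<lambda>t. vector_derivative X (at t))
    (\<lambda>t. vector_derivative (\<lambda>t. vector_derivative X (at t)) (at t)) N I" and "I \<noteq> {}"
proof -
  let ?X1 = "\<lambda>t. vector_derivative X (at t)"
  let ?X2 = "\<lambda>t. vector_derivative ?X1 (at t)"
  have reg: "regular_curve X I" and nrm: "convex_side_unit_normal X I N"
    using assms by (auto simp: strictly_locally_convex_def locally_convex_curve_def)
  obtain \<phi> J where rep: "arc_length_reparam X I \<phi> J" and
    curv: "\<And>v. v \<in> J \<Longrightarrow> curvature (X \<circ> \<phi>) (N \<circ> \<phi>) v > 0"
    using assms by (auto simp: strictly_locally_convex_def)
  have C: "C_diff_on 3 X I" and int: "open I" "is_interval I" "I \<noteq> {}"
    and ne: "\<And>t. t \<in> I \<Longrightarrow> ?X1 t \<noteq> 0"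
    using reg by (auto simp: regular_curve_def open_interval_def)
  have d1: "(X has_vector_derivative ?X1 t) (at t)" and d2: "(?X1 has_vector_derivative ?X2 t) (at t)"
    and d3: "?X2 differentiable (at t)" if "t \<in> I" for t
    using C that by (auto simp: numeral_3_eq_3 vector_derivative_works[symmetric])
  have c2: "continuous_on I ?X2"
    using d3 by (auto intro!: continuous_at_imp_continuous_on intro: differentiable_imp_continuous_within)
  have N: "norm (N t) = 1" "N t \<bullet> ?X1 t = 0" if "t \<in> I" for t
    using nrm that by (auto simp: convex_side_unit_normal_def)
  have J: "open J" "\<phi> ` J = I" and Cp: "C_diff_on 3 \<phi> J"
    using rep by (auto simp: arc_length_reparam_def open_interval_def bij_betw_def)
  let ?p1 = "\<lambda>t. vector_derivative \<phi> (at t)"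
  let ?p2 = "\<lambda>t. vector_derivative ?p1 (at t)"
  have p1: "(\<phi> has_vector_derivative ?p1 t) (at t)" and p2: "(?p1 has_vector_derivative ?p2 t) (at t)"
    if "t \<in> J" for t
    using Cp that by (auto simp: numeral_3_eq_3 vector_derivative_works[symmetric])
  have "?X2 t \<bullet> N t > 0" if t: "t \<in> I" for t
  proof -
    obtain v where v: "v \<in> J" "\<phi> v = t" using J(2) t by blast
    have chain: "((X \<circ> \<phi>) has_vector_derivative ?p1 x *\<^sub>R ?X1 (\<phi> x)) (at x)" if "x \<in> J" for x
      using J that by (intro vector_diff_chain_at p1 d1) auto
    have "((\<lambda>x. ?p1 x *\<^sub>R ?X1 (\<phi> x)) has_vector_derivative
        ?p1 v *\<^sub>R (?p1 v *\<^sub>R ?X2 (\<phi> v)) + ?p2 v *\<^sub>R ?X1 (\<phi> v)) (at v)"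
      using v J p1[OF v(1)] p2[OF v(1)] d2[of "\<phi> v"] vector_diff_chain_at[of \<phi> "?p1 v" v ?X1 "?X2 (\<phi> v)"]
      by (intro has_vector_derivative_scaleR) (auto simp: o_def has_real_derivative_iff_has_vector_derivative)
    moreover have "\<forall>\<^sub>F x in nhds v. vector_derivative (X \<circ> \<phi>) (at x) = ?p1 x *\<^sub>R ?X1 (\<phi> x)"
      using eventually_nhds_in_open[OF J(1) v(1)]
      by eventually_elim (rule vector_derivative_at[OF chain])
    ultimately have "((\<lambda>x. vector_derivative (X \<circ> \<phi>) (at x)) has_vector_derivative
        ?p1 v *\<^sub>R (?p1 v *\<^sub>R ?X2 (\<phi> v)) + ?p2 v *\<^sub>R ?X1 (\<phi> v)) (at v)"
      by (subst has_vector_derivative_cong_ev) (auto elim: eventually_mono dest: eventually_nhds_x_imp_x)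
    then have "curvature (X \<circ> \<phi>) (N \<circ> \<phi>) v = (?p1 v *\<^sub>R (?p1 v *\<^sub>R ?X2 t) + ?p2 v *\<^sub>R ?X1 t) \<bullet> N t"
      unfolding curvature_def by (simp add: vector_derivative_at v)
    also have "\<dots> = (?p1 v)\<^sup>2 * (?X2 t \<bullet> N t)"
      using N(2)[OF t] by (simp add: inner_add_left inner_commute[of _ "N t"] inner_add_right power2_eq_square)
    finally show ?thesis using curv[OF v(1)] by (simp add: zero_less_mult_iff)
  qed
  then show "strict_curve X ?X1 ?X2 N I"
    by unfold_locales (use int d1 d2 c2 ne N in auto)
  show "I \<noteq> {}" by (rule int)
qed

theorem theorem4:
  fixes X N :: "real \<Rightarrow> real^2" and I :: "real set"
  assumes "strictly_locally_convex X I N"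
  shows "open_part_of_parabola (X ` I) \<longleftrightarrow>
    (\<forall>s\<in>I. \<forall>\<^sub>F h in at_right 0. centroid_dist X I N s h = 3 / 5 * h)"
  using strict_curve.open_part_iff_centroid strictly_locally_convex_imp_strict_curve[OF assms] by blast

end
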